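(* Let $w>0$, let $g_0=0$ and let $g_k>0$ for $k\ge1$ be such that $Z:=\sum_{n=0}^\infty\prod_{k=1}^ng_k^{-1}<\infty$. Let $N\in\mathbb{N}$ and $x^*\in\mathbb{Z}$. Start the totally asymmetric headway exclusion process (TAHEP) with $N$ particles on $\mathbb{Z}$, with jump rates $w_n=w\,g_n$ ($n\in\mathbb{N}_0$) and $w_\infty=w$, from the domain measure $\mu^{x^*}$. Then for all $t>0$ the distribution $\mu^{x^*}_t$ of the process at time $t$ is the convex combination of domain measures $$\mu^{x^*}_t(\mathbf{x})=\sum_{y=x^*}^\infty\tilde q_t(y,x^* )\,\mu^y(\mathbf{x}),\qquad \mathbf{x}\in\Omega^*_N,$$ with weights $$\tilde q_t(y,x^* )=e^{-wt}\frac{(wt)^{y-x^*}}{(y-x^* )!},$$ i.e. the transition probability from $y$ to $x^*$ in time $t$ of a single totally asymmetric random walk on $\mathbb{Z}$ with jumps to the left at rate $w$ (equivalently, from $x^*$ to $y$ of the walk with jumps to the right at rate $w$).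
   Context: $\Omega^*_N$ is the (countable) set of configurations of $N$ exclusion particles on $\mathbb{Z}$, written as $\mathbf{x}=(x_1,\dots,x_N)$ with $x_1<x_2<\dots<x_N$ integers. The headway of particle $i$ is $n_i=x_{i+1}-x_i-1$ for $i<N$ and $n_N=\infty$. The TAHEP with $N$ particles on $\mathbb{Z}$ with rates $\{w_n\}_{n\in\mathbb{N}_0\cup\{\infty\}}$ is the continuous-time Markov chain on $\Omega^*_N$ in which, independently, each particle $i$ jumps from $x_i$ to $x_i+1$ at rate $w_{n_i}$ (since $w_0=0$, no jump to an occupied site occurs). In terms of an interaction potential $J$ with $J(k)\in\mathbb{R}$, $k\geq 1$, the numbers $g_k$ are $g_k=e^{J(k+1)-J(k)}$ for $k\ge1$. Domain measures: for $y\in\mathbb{Z}$, $\mu^y$ is the probability measure on $\Omega^*_N$ given by $$\mu^y(\mathbf{x})=\frac{\delta_{x_1,y}}{Z^{N-1}}\prod_{i=1}^{N-1}\ \prod_{k=1}^{x_{i+1}-x_i-1}g_k^{-1}$$ (empty products equal $1$; $\delta$ is the Kronecker delta). *)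

theory Defs
  imports "HOL-Probability.Probability"
begin

section \<open>Continuous-time Markov chains with given jump rates\<close>

text \<open>
  \<^term>\<open>q x y\<close> is the rate of the jump from \<^term>\<open>x\<close> to \<^term>\<open>y \<noteq> x\<close>; the diagonal of \<^term>\<open>q\<close>
  is ignored throughout.
\<close>

definition exit_rate :: "'s set \<Rightarrow> ('s \<Rightarrow> 's \<Rightarrow> real) \<Rightarrow> 's \<Rightarrow> real" where
  "exit_rate S q x = infsum (q x) (S - {x})"

definition jump_prob :: "'s set \<Rightarrow> ('s \<Rightarrow> 's \<Rightarrow> real) \<Rightarrow> 's \<Rightarrow> 's \<Rightarrow> real" where
  "jump_prob S q x y =
     (if exit_rate S q x = 0 then (if y = x then 1 else 0)
      else if y = x then 0 else q x y / exit_rate S q x)"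

text \<open>
  The jump-chain/holding-time description: \<^term>\<open>Y\<close> is the sequence of visited states, and
  \<^term>\<open>H n\<close> is the time spent in \<^term>\<open>Y n\<close>. The assumption \<open>law\<close> says that \<^term>\<open>Y\<close> is
  the discrete-time Markov chain with initial law \<^term>\<open>\<mu>\<close> and transition matrix
  \<^term>\<open>jump_prob S q\<close>, and that given \<^term>\<open>Y\<close> the holding times are independent, the
  \<^term>\<open>n\<close>-th one being exponential with parameter \<^term>\<open>exit_rate S q (Y n)\<close> (almost surely
  infinite if this parameter is \<^term>\<open>0::real\<close>, i.e. if \<^term>\<open>Y n\<close> is absorbing).
\<close>

locale jump_chain_holding_times = prob_space M
  for M :: "'m measure" and S :: "'s set" and q :: "'s \<Rightarrow> 's \<Rightarrow> real" and \<mu> :: "'s \<Rightarrow> real"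
    and Y :: "nat \<Rightarrow> 'm \<Rightarrow> 's" and H :: "nat \<Rightarrow> 'm \<Rightarrow> ennreal" +
  assumes measurable_jump_chain: "\<And>n. Y n \<in> measurable M (count_space S)"
    and measurable_holding_time: "\<And>n. H n \<in> borel_measurable M"
    and law: "\<And>n y s. (\<And>k. k \<le> n \<Longrightarrow> y k \<in> S) \<Longrightarrow> (\<And>k. k \<le> n \<Longrightarrow> 0 \<le> s k) \<Longrightarrow>
      measure M {\<omega> \<in> space M. \<forall>k\<le>n. Y k \<omega> = y k \<and> ennreal (s k) < H k \<omega>} =
        \<mu> (y 0) * (\<Prod>k<n. jump_prob S q (y k) (y (Suc k)))
          * (\<Prod>k\<le>n. exp (- exit_rate S q (y k) * s k))"

text \<open>
  \<^term>\<open>X t \<omega>\<close> is the state at time \<^term>\<open>t\<close>: it equals \<^term>\<open>Y n \<omega>\<close> from the \<^term>\<open>n\<close>-th jump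
  time on (inclusively) up to the next one. Should the jump times accumulate, nothing is required
  of \<^term>\<open>X\<close> after the explosion time except that its values lie in \<^term>\<open>S\<close>.
\<close>

locale continuous_time_markov_chain = prob_space M
  for M :: "'m measure" and S :: "'s set" and q :: "'s \<Rightarrow> 's \<Rightarrow> real" and \<mu> :: "'s \<Rightarrow> real"
    and X :: "real \<Rightarrow> 'm \<Rightarrow> 's" +
  assumes countable_states: "countable S"
    and rate_nonneg: "\<And>x y. x \<in> S \<Longrightarrow> y \<in> S \<Longrightarrow> x \<noteq> y \<Longrightarrow> 0 \<le> q x y"
    and rate_summable: "\<And>x. x \<in> S \<Longrightarrow> q x summable_on (S - {x})"
    and measurable_state: "\<And>t. 0 \<le> t \<Longrightarrow> X t \<in> measurable M (count_space S)"
    and jump_description: "\<exists>Y H. jump_chain_holding_times M S q \<mu> Y H \<and>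
      (AE \<omega> in M. \<forall>t\<ge>0. \<forall>n.
         (\<Sum>k<n. H k \<omega>) \<le> ennreal t \<and> ennreal t < (\<Sum>k<Suc n. H k \<omega>) \<longrightarrow> X t \<omega> = Y n \<omega>)"


section \<open>The totally asymmetric headway exclusion process\<close>

text \<open>
  A configuration is the strictly increasing list of the particle positions. List indices start
  at 0, so the leftmost particle is \<^term>\<open>xs ! 0\<close> and the rightmost one \<^term>\<open>xs ! (N - 1)\<close>.
\<close>

definition configurations :: "nat \<Rightarrow> int list set" where
  "configurations N = {xs. length xs = N \<and> sorted_wrt (<) xs}"

definition headway :: "int list \<Rightarrow> nat \<Rightarrow> enat" where
  "headway xs i =
     (if Suc i < length xs then enat (nat (xs ! Suc i - xs ! i - 1)) else \<infinity>)"

definition tahep_rate :: "(enat \<Rightarrow> real) \<Rightarrow> int list \<Rightarrow> int list \<Rightarrow> real" where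
  "tahep_rate W xs ys =
     (\<Sum>i<length xs. if ys = xs[i := xs ! i + 1] then W (headway xs i) else 0)"

definition is_tahep ::
  "'m measure \<Rightarrow> nat \<Rightarrow> (enat \<Rightarrow> real) \<Rightarrow> (int list \<Rightarrow> real) \<Rightarrow> (real \<Rightarrow> 'm \<Rightarrow> int list) \<Rightarrow> bool" where
  "is_tahep M N W \<mu> X \<longleftrightarrow>
     continuous_time_markov_chain M (configurations N) (tahep_rate W) \<mu> X"

definition headway_rates :: "real \<Rightarrow> (nat \<Rightarrow> real) \<Rightarrow> enat \<Rightarrow> real" where
  "headway_rates w g n = (case n of enat k \<Rightarrow> w * g k | \<infinity> \<Rightarrow> w)"

definition partition_function :: "(nat \<Rightarrow> real) \<Rightarrow> real" where
  "partition_function g = (\<Sum>n. \<Prod>k=1..n. inverse (g k))"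

definition domain_measure :: "(nat \<Rightarrow> real) \<Rightarrow> nat \<Rightarrow> int \<Rightarrow> int list \<Rightarrow> real" where
  "domain_measure g N y xs =
     (if xs ! 0 = y then 1 else 0) / partition_function g ^ (N - 1)
       * (\<Prod>i<N - 1. \<Prod>k=1..nat (xs ! Suc i - xs ! i - 1). inverse (g k))"


section \<open>Totally asymmetric random walks\<close>

definition is_left_walk :: "'m measure \<Rightarrow> real \<Rightarrow> int \<Rightarrow> (real \<Rightarrow> 'm \<Rightarrow> int) \<Rightarrow> bool" where
  "is_left_walk M w a X \<longleftrightarrow>
     continuous_time_markov_chain M UNIV (\<lambda>x y. if y = x - 1 then w else 0)
       (\<lambda>x. if x = a then 1 else 0) X"

definition is_right_walk :: "'m measure \<Rightarrow> real \<Rightarrow> int \<Rightarrow> (real \<Rightarrow> 'm \<Rightarrow> int) \<Rightarrow> bool" where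
  "is_right_walk M w a X \<longleftrightarrow>
     continuous_time_markov_chain M UNIV (\<lambda>x y. if y = x + 1 then w else 0)
       (\<lambda>x. if x = a then 1 else 0) X"

definition walk_weight :: "real \<Rightarrow> real \<Rightarrow> int \<Rightarrow> int \<Rightarrow> real" where
  "walk_weight w t y x = exp (- (w * t)) * (w * t) ^ nat (y - x) / fact (nat (y - x))"

end

theory Submission
  imports Defs
begin

text \<open>
  Write \<open>P s k\<close> for the Poisson weight of \<open>k\<close> with mean \<open>w s\<close> and \<open>m\<close> for the product weight
  of the gaps of a configuration. In the forward equation for \<open>f s x = P s (x\<^sub>1 - x\<^sup>*) m x\<close>, a jump of
  a particle other than the leftmost one into \<open>x\<close> carries the flow
  \<open>w g(n) f s x\<close>, where \<open>n\<close> is the headway in \<open>x\<close> of its left neighbour, and the jump of the leftmost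
  particle carries \<open>w P s (x\<^sub>1 - x\<^sup>* - 1) m x\<close>. The first kind of flow cancels against the exit rate
  except for a remaining rate \<open>w\<close>, and what is left is the forward equation of the
  Poisson process, so \<open>f\<close> solves the forward equation of the process.

  The sums of the probabilities of being in \<open>x\<close> at time \<open>s\<close> after at most \<open>n\<close> jumps
  stay below every nonnegative solution. Since \<open>f\<close> has total mass one, it is the law of the
  process as soon as there is no explosion. As the rightmost particle jumps at rate \<open>w\<close>
  and the others can only catch up with it, the function
  \<open>u = 2\<close> to the power of the total distance to the rightmost particle satisfies
  \<open>(\<Sum>y. q x y * u y) \<le> 1/2 (\<theta> + q x) u x\<close> for \<open>\<theta> = w 2\<^sup>N\<close>, with \<open>q x\<close> the exit rate.
  Hence the expectation of \<open>exp (- \<theta> T\<^sub>n) u(Y\<^sub>n) / u(Y\<^sub>0)\<close> is at most \<open>2\<^sup>-\<^sup>n\<close>,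
  so the jump times \<open>T\<^sub>n\<close> tend to infinity.
\<close>

section \<open>Exponential distributions\<close>

definition exponential :: "real \<Rightarrow> real measure" where
  "exponential l = density lborel (\<lambda>x. ennreal (exponential_density l x))"

lemma prob_space_exponential: "0 < l \<Longrightarrow> prob_space (exponential l)"
  unfolding exponential_def by (rule prob_space_exponential_density)

lemma sets_exponential [measurable_cong, simp]: "sets (exponential l) = sets borel"
  by (simp add: exponential_def)

lemma space_exponential [simp]: "space (exponential l) = UNIV"
  by (simp add: exponential_def)

lemma nn_integral_exponential:
  "f \<in> borel_measurable borel \<Longrightarrow>
    (\<integral>\<^sup>+x. f x \<partial>exponential l) = (\<integral>\<^sup>+x. ennreal (exponential_density l x) * f x \<partial>lborel)"
  by (simp add: exponential_def nn_integral_density)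

text \<open>Strict tails determine the distribution function by complementation. Tails are the
  convenient form here because the law of the holding times is given through events
  \<open>s < H\<close>.\<close>

lemma (in prob_space) distr_exponentialI:
  assumes [measurable]: "X \<in> borel_measurable M" and l: "0 < l"
    and tail: "\<And>a. 0 \<le> a \<Longrightarrow> prob {x \<in> space M. a < X x} = exp (- l * a)"
  shows "distr M borel X = exponential l"
proof -
  have "distributed M lborel X (exponential_density l)"
  proof (rule exponential_distributedI)
    fix a :: real assume "0 \<le> a"
    have "prob {x \<in> space M. X x \<le> a} = prob (space M - {x \<in> space M. a < X x})"
      by (intro arg_cong[where f=prob]) auto
    also have "\<dots> = 1 - exp (- a * l)"
      by (subst prob_compl) (auto simp: tail \<open>0 \<le> a\<close> mult.commute)
    finally show "emeasure M {x \<in> space M. X x \<le> a} = 1 - ennreal (exp (- a * l))"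
      using \<open>0 \<le> a\<close> l by (simp add: emeasure_eq_measure ennreal_minus flip: ennreal_1)
  qed (use l in auto)
  then have "distr M lborel X = exponential l"
    by (simp add: distributed_def exponential_def)
  moreover have "distr M lborel X = distr M borel X"
    by (intro distr_cong) auto
  ultimately show ?thesis by simp
qed

lemma emeasure_exponential_greaterThan:
  assumes l: "0 < l" and a: "0 \<le> a"
  shows "emeasure (exponential l) {a <..} = ennreal (exp (- l * a))"
proof -
  interpret prob_space "exponential l" by (rule prob_space_exponential[OF l])
  have "distr (exponential l) lborel (\<lambda>x. x) = density lborel (exponential_density l)"
    by (rule trans[OF distr_id2]) (simp_all add: exponential_def)
  then have "distributed (exponential l) lborel (\<lambda>x. x) (exponential_density l)"
    by (simp add: distributed_def)
  from exponential_distributedD_gt[OF this a l] show ?thesis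
    by (simp add: emeasure_eq_measure mult.commute greaterThan_def)
qed

text \<open>Multiplying the density of rate \<open>l\<close> by \<open>exp (- a * e)\<close> gives
  \<open>l / (a + l)\<close> times the density of rate \<open>a + l\<close>, which has mass one.
  This Laplace transform produces the discount of one holding time in the non-explosion
  argument.\<close>

lemma nn_integral_exponential_exp:
  assumes l: "0 < l" and a: "0 \<le> a"
  shows "(\<integral>\<^sup>+e. ennreal (exp (- a * e)) \<partial>exponential l) = ennreal (l / (a + l))"
proof -
  interpret prob_space "exponential (a + l)"
    using assms by (intro prob_space_exponential) simp
  have "(\<integral>\<^sup>+e. ennreal (exp (- a * e)) \<partial>exponential l)
      = (\<integral>\<^sup>+e. ennreal (exponential_density l e) * ennreal (exp (- a * e)) \<partial>lborel)"
    by (rule nn_integral_exponential) measurable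
  also have "\<dots> = (\<integral>\<^sup>+e. ennreal (l / (a + l)) * (ennreal (exponential_density (a + l) e) * 1) \<partial>lborel)"
  proof (intro nn_integral_cong)
    fix e :: real
    have "exponential_density l e * exp (- a * e) = l / (a + l) * exponential_density (a + l) e"
      using assms by (simp add: exponential_density_def mult.assoc flip: exp_add)
        (simp add: algebra_simps)
    then show "ennreal (exponential_density l e) * ennreal (exp (- a * e))
        = ennreal (l / (a + l)) * (ennreal (exponential_density (a + l) e) * 1)"
      using assms exponential_density_nonneg[of l e] exponential_density_nonneg[of "a + l" e]
      by (simp flip: ennreal_mult)
  qed
  also have "\<dots> = ennreal (l / (a + l)) * (\<integral>\<^sup>+e. 1 \<partial>exponential (a + l))"
    unfolding nn_integral_exponential[OF borel_measurable_const] by (rule nn_integral_cmult) measurable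
  also have "(\<integral>\<^sup>+e. 1 \<partial>exponential (a + l)) = 1"
    using emeasure_space_1 by simp
  finally show ?thesis by simp
qed

section \<open>The law of a chain with positive exit rates\<close>

text \<open>Links the exit rates, which are unordered real sums, to the nonnegative integrals in
  which all later sums over states are computed.\<close>

lemma nn_integral_count_space_eq_infsum:
  fixes f :: "'a \<Rightarrow> real"
  assumes "f summable_on A" and nonneg: "\<And>x. x \<in> A \<Longrightarrow> 0 \<le> f x"
  shows "(\<integral>\<^sup>+x. ennreal (f x) \<partial>count_space A) = ennreal (infsum f A)"
proof -
  have *: "Infinite_Set_Sum.abs_summable_on f A"
    using summable_on_iff_abs_summable_on_real[THEN iffD1, OF assms(1)]
    by (simp add: abs_summable_equivalent[symmetric] abs_summable_on_def)
  then show ?thesis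
    using nonneg by (simp add: nn_integral_conv_infsetsum infsetsum_infsum)
qed

text \<open>Positive exit rates exclude absorbing states and make the holding times almost surely
  finite. For the walks and for the exclusion process a jump at rate \<open>w\<close> is always
  available.\<close>

locale positive_rate_jump_chain = jump_chain_holding_times M S q \<mu> Y H
  for M :: "'m measure" and S :: "'s set" and q \<mu> Y H +
  assumes countable_S: "countable S"
    and q_nonneg: "\<And>x y. x \<in> S \<Longrightarrow> y \<in> S \<Longrightarrow> x \<noteq> y \<Longrightarrow> 0 \<le> q x y"
    and q_summable: "\<And>x. x \<in> S \<Longrightarrow> q x summable_on (S - {x})"
    and exit_rate_pos: "\<And>x. x \<in> S \<Longrightarrow> 0 < exit_rate S q x"
    and init_sum: "(\<integral>\<^sup>+x. ennreal (\<mu> x) \<partial>count_space S) = 1"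
begin

abbreviation "p \<equiv> jump_prob S q"
abbreviation "r \<equiv> exit_rate S q"

declare measurable_jump_chain [measurable] measurable_holding_time [measurable]

lemma measurable_jump_chain_Collect [measurable]:
  "Measurable.pred M (\<lambda>\<omega>. Y n \<omega> = x)"
proof -
  have "{\<omega>\<in>space M. Y n \<omega> = x} = (if x \<in> S then Y n -` {x} \<inter> space M else {})"
    using measurable_space[OF measurable_jump_chain] by auto
  also have "\<dots> \<in> sets M"
    using measurable_sets[OF measurable_jump_chain, of "{x}" n] by auto
  finally show ?thesis by (simp add: pred_def)
qed

lemma Y_in_S: "\<omega> \<in> space M \<Longrightarrow> Y n \<omega> \<in> S"
  using measurable_space[OF measurable_jump_chain, of \<omega> n] by simp

lemma p_nonneg: "x \<in> S \<Longrightarrow> z \<in> S \<Longrightarrow> 0 \<le> p x z"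
  using exit_rate_pos[of x] q_nonneg[of x z] by (auto simp: jump_prob_def)

lemma nn_integral_rates:
  assumes "x \<in> S"
  shows "(\<integral>\<^sup>+z. ennreal (q x z) \<partial>count_space (S - {x})) = ennreal (r x)"
  unfolding exit_rate_def using assms
  by (intro nn_integral_count_space_eq_infsum q_summable) (auto intro!: q_nonneg)

lemma nn_integral_jump_prob:
  assumes x: "x \<in> S"
  shows "(\<integral>\<^sup>+z. ennreal (p x z) \<partial>count_space S) = 1"
proof -
  have "(\<integral>\<^sup>+z. ennreal (p x z) \<partial>count_space S)
      = (\<integral>\<^sup>+z. ennreal (p x z) \<partial>count_space (S - {x}))"
    using exit_rate_pos[OF x] by (intro nn_integral_count_space_eq) (auto simp: jump_prob_def)
  also have "\<dots> = (\<integral>\<^sup>+z. ennreal (q x z) / ennreal (r x) \<partial>count_space (S - {x}))"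
    using exit_rate_pos[OF x] q_nonneg[OF x]
    by (intro nn_integral_cong) (auto simp: jump_prob_def divide_ennreal)
  also have "\<dots> = ennreal (r x) / ennreal (r x)"
    by (subst nn_integral_divide) (auto simp: nn_integral_rates[OF x])
  also have "\<dots> = 1"
    using exit_rate_pos[OF x] by (simp add: divide_ennreal)
  finally show ?thesis .
qed

text \<open>For a path of length zero and threshold zero, \<open>law\<close> exhibits
  \<open>\<mu> x\<close> as the measure of an event.\<close>

lemma init_nonneg: assumes x: "x \<in> S" shows "0 \<le> \<mu> x"
proof -
  have "0 \<le> \<mu> x * (\<Prod>k<(0::nat). p x x) * (\<Prod>k\<le>(0::nat). exp (- r x * 0))"
    by (rule ord_le_eq_trans[OF measure_nonneg law[of 0 "\<lambda>_. x" "\<lambda>_. 0", OF x order_refl]])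
  then show ?thesis by simp
qed

section \<open>Path events, positivity and finiteness of the holding times\<close>

definition path_prob :: "(nat \<Rightarrow> 's) \<Rightarrow> nat \<Rightarrow> real" where
  "path_prob y n = \<mu> (y 0) * (\<Prod>k<n. p (y k) (y (Suc k)))"

definition path_event :: "(nat \<Rightarrow> 's) \<Rightarrow> nat \<Rightarrow> 'm set" where
  "path_event y n = {\<omega> \<in> space M. \<forall>k\<le>n. Y k \<omega> = y k}"

lemma path_event_sets [measurable]: "path_event y n \<in> sets M"
  unfolding path_event_def by measurable

lemma path_prob_nonneg: "(\<And>k. k \<le> n \<Longrightarrow> y k \<in> S) \<Longrightarrow> 0 \<le> path_prob y n"
  unfolding path_prob_def
  by (rule mult_nonneg_nonneg[OF init_nonneg prod_nonneg]) (simp_all add: p_nonneg)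

lemma path_prob_Suc: "path_prob y (Suc n) = path_prob y n * p (y n) (y (Suc n))"
  by (simp add: path_prob_def)

text \<open>The state space is countable, so there are only countably many paths with
  \<open>n\<close> steps and the exceptional null sets of the single paths can be united.\<close>

lemma AE_paths:
  assumes "\<And>y. (\<And>k. k \<le> n \<Longrightarrow> y k \<in> S) \<Longrightarrow> AE \<omega> in M. \<omega> \<in> path_event y n \<longrightarrow> P \<omega>"
  shows "AE \<omega> in M. P \<omega>"
proof -
  let ?I = "PiE {..n} (\<lambda>_. S)"
  have "AE \<omega> in M. \<forall>y\<in>?I. \<omega> \<in> path_event y n \<longrightarrow> P \<omega>"
    using assms by (subst AE_ball_countable) (auto intro!: countable_PiE countable_S)
  then show ?thesis
  proof (rule AE_mp, intro AE_I2 impI)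
    fix \<omega> assume \<omega>: "\<omega> \<in> space M" "\<forall>y\<in>?I. \<omega> \<in> path_event y n \<longrightarrow> P \<omega>"
    let ?y = "\<lambda>k\<in>{..n}. Y k \<omega>"
    have "?y \<in> ?I" "\<omega> \<in> path_event ?y n"
      using \<omega> Y_in_S by (auto simp: path_event_def)
    then show "P \<omega>" using \<omega> by blast
  qed
qed

lemma emeasure_law:
  assumes "\<And>k. k \<le> n \<Longrightarrow> y k \<in> S" "\<And>k. k \<le> n \<Longrightarrow> 0 \<le> s k"
  shows "emeasure M {\<omega> \<in> space M. \<forall>k\<le>n. Y k \<omega> = y k \<and> ennreal (s k) < H k \<omega>} =
    ennreal (path_prob y n * (\<Prod>k\<le>n. exp (- r (y k) * s k)))"
  using law[of n y s] assms by (simp add: emeasure_eq_measure path_prob_def)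

lemma emeasure_split_state:
  assumes [measurable]: "Measurable.pred M P"
  shows "emeasure M {\<omega> \<in> space M. P \<omega>}
    = (\<integral>\<^sup>+z. emeasure M {\<omega> \<in> space M. P \<omega> \<and> Y n \<omega> = z} \<partial>count_space S)"
proof -
  have "{\<omega> \<in> space M. P \<omega>} = (\<Union>z\<in>S. {\<omega> \<in> space M. P \<omega> \<and> Y n \<omega> = z})"
    using Y_in_S by auto
  also have "emeasure M \<dots> = (\<integral>\<^sup>+z. emeasure M {\<omega> \<in> space M. P \<omega> \<and> Y n \<omega> = z} \<partial>count_space S)"
    by (intro emeasure_UN_countable countable_S) (auto simp: disjoint_family_on_def)
  finally show ?thesis .
qed

text \<open>
  The assumption \<open>law\<close> only describes events on which the holding times are positive. They have
  full measure because \<open>\<mu>\<close> and the rows of the transition matrix have total mass one.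
\<close>
lemma AE_holding_time_pos: "AE \<omega> in M. \<forall>k. 0 < H k \<omega>"
proof -
  have "AE \<omega> in M. \<forall>k\<le>n. 0 < H k \<omega>" for n
  proof (induction n)
    case 0
    have "emeasure M {\<omega> \<in> space M. 0 < H 0 \<omega>}
        = (\<integral>\<^sup>+z. emeasure M {\<omega> \<in> space M. 0 < H 0 \<omega> \<and> Y 0 \<omega> = z} \<partial>count_space S)"
      by (intro emeasure_split_state) simp
    also have "\<dots> = (\<integral>\<^sup>+z. ennreal (\<mu> z) \<partial>count_space S)"
    proof (intro nn_integral_cong)
      fix z assume "z \<in> space (count_space S)"
      then show "emeasure M {\<omega> \<in> space M. 0 < H 0 \<omega> \<and> Y 0 \<omega> = z} = ennreal (\<mu> z)"
        using emeasure_law[of 0 "\<lambda>_. z" "\<lambda>_. 0"] by (simp add: path_prob_def conj_commute)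
    qed
    finally have "prob {\<omega> \<in> space M. 0 < H 0 \<omega>} = 1"
      using init_sum by (simp add: measure_def)
    then have "AE \<omega> in M. 0 < H 0 \<omega>" by (subst (asm) prob_Collect_eq_1) auto
    then show ?case by simp
  next
    case (Suc n)
    have "AE \<omega> in M. (\<forall>k\<le>n. 0 < H k \<omega>) \<longrightarrow> 0 < H (Suc n) \<omega>"
    proof (rule AE_paths[of n])
      fix y assume y: "\<And>k. k \<le> n \<Longrightarrow> y k \<in> S"
      let ?P = "\<lambda>\<omega>. \<forall>k\<le>n. Y k \<omega> = y k \<and> ennreal 0 < H k \<omega>"
      let ?A = "{\<omega> \<in> space M. ?P \<omega>}"
      let ?B = "{\<omega> \<in> space M. ?P \<omega> \<and> 0 < H (Suc n) \<omega>}"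
      have A: "emeasure M ?A = ennreal (path_prob y n)"
        using emeasure_law[of n y "\<lambda>_. 0"] y by simp
      have "emeasure M ?B
          = (\<integral>\<^sup>+z. emeasure M {\<omega> \<in> space M. (?P \<omega> \<and> 0 < H (Suc n) \<omega>) \<and> Y (Suc n) \<omega> = z}
              \<partial>count_space S)"
        by (rule emeasure_split_state) measurable
      also have "\<dots> = (\<integral>\<^sup>+z. ennreal (path_prob y n) * ennreal (p (y n) z) \<partial>count_space S)"
      proof (intro nn_integral_cong)
        fix z assume z: "z \<in> space (count_space S)"
        let ?y = "y(Suc n := z)"
        have "emeasure M {\<omega> \<in> space M. (?P \<omega> \<and> 0 < H (Suc n) \<omega>) \<and> Y (Suc n) \<omega> = z} =
          emeasure M {\<omega> \<in> space M. \<forall>k\<le>Suc n. Y k \<omega> = ?y k \<and> ennreal 0 < H k \<omega>}"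
          by (intro arg_cong[where f="emeasure M"]) (auto simp: le_Suc_eq)
        also have "\<dots> = ennreal (path_prob ?y (Suc n))"
          using y z by (subst emeasure_law[of "Suc n" ?y "\<lambda>_. 0"]) (auto simp: le_Suc_eq)
        also have "path_prob ?y (Suc n) = path_prob y n * p (y n) z"
          unfolding path_prob_Suc by (simp add: path_prob_def)
        finally show "emeasure M {\<omega> \<in> space M. (?P \<omega> \<and> 0 < H (Suc n) \<omega>) \<and> Y (Suc n) \<omega> = z}
          = ennreal (path_prob y n) * ennreal (p (y n) z)"
          using path_prob_nonneg[of n y] y by (simp add: ennreal_mult')
      qed
      also have "\<dots> = emeasure M ?A"
        using y A by (simp add: nn_integral_cmult nn_integral_jump_prob)
      finally have "emeasure M (?A - ?B) = 0"
        by (subst emeasure_Diff) auto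
      then have "AE \<omega> in M. \<omega> \<notin> ?A - ?B"
        by (intro AE_not_in) auto
      then show "AE \<omega> in M. \<omega> \<in> path_event y n \<longrightarrow> (\<forall>k\<le>n. 0 < H k \<omega>) \<longrightarrow> 0 < H (Suc n) \<omega>"
        by eventually_elim (auto simp: path_event_def zero_less_iff_neq_zero)
    qed
    with Suc show ?case by eventually_elim (auto simp: le_Suc_eq)
  qed
  then have "AE \<omega> in M. \<forall>n. \<forall>k\<le>n. 0 < H k \<omega>" by (simp add: AE_all_countable)
  then show ?thesis by eventually_elim auto
qed

text \<open>An infinite holding time exceeds every threshold \<open>m\<close>, and on a fixed path
  this has probability at most a multiple of \<open>exp (- r (y n) * m)\<close>. The bound tends to
  zero because the exit rate is positive.\<close>

lemma AE_holding_time_finite: "AE \<omega> in M. \<forall>k. H k \<omega> < \<infinity>"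
proof -
  have "AE \<omega> in M. H n \<omega> < \<infinity>" for n
  proof (rule AE_paths[of n])
    fix y assume y: "\<And>k. k \<le> n \<Longrightarrow> y k \<in> S"
    let ?A = "{\<omega> \<in> space M. (\<forall>k\<le>n. Y k \<omega> = y k \<and> 0 < H k \<omega>) \<and> H n \<omega> = \<infinity>}"
    have le: "measure M ?A \<le> path_prob y n * exp (- r (y n) * real m)" for m
    proof -
      have "measure M ?A
        \<le> measure M {\<omega> \<in> space M. \<forall>k\<le>n. Y k \<omega> = y k \<and> ennreal ((\<lambda>k. if k = n then real m else 0) k) < H k \<omega>}"
        by (intro finite_measure_mono) auto
      also have "\<dots> = path_prob y n * (\<Prod>k\<le>n. exp (- r (y k) * (if k = n then real m else 0)))"
        by (subst law) (auto simp: y path_prob_def)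
      also have "(\<Prod>k\<le>n. exp (- r (y k) * (if k = n then real m else 0))) =
          (\<Prod>k\<le>n. if k = n then exp (- r (y n) * real m) else 1)"
        by (intro prod.cong) auto
      finally show ?thesis by simp
    qed
    have "(\<lambda>m. path_prob y n * exp (- r (y n) * real m)) \<longlonglongrightarrow> path_prob y n * 0"
      using exit_rate_pos[of "y n"] y[of n]
      by (intro tendsto_mult tendsto_const filterlim_compose[OF exp_at_bot]
          filterlim_tendsto_neg_mult_at_bot[OF tendsto_const _ filterlim_real_sequentially]) auto
    then have "measure M ?A \<le> path_prob y n * 0"
      by (rule LIMSEQ_le_const) (use le in auto)
    then have "emeasure M ?A = 0"
      using measure_nonneg[of M ?A] by (simp add: emeasure_eq_measure antisym)
    then have "AE \<omega> in M. \<omega> \<notin> ?A"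
      by (intro AE_not_in) (auto intro!: null_setsI)
    then show "AE \<omega> in M. \<omega> \<in> path_event y n \<longrightarrow> H n \<omega> < \<infinity>"
      using AE_holding_time_pos
      by eventually_elim (auto simp: path_event_def less_top)
  qed
  then show ?thesis by (simp add: AE_all_countable)
qed

section \<open>Joint law of the path and the holding times\<close>

text \<open>Real-valued holding times. The value infinity is sent to 0, which matters only on a null
  set and keeps \<open>h\<close> nonnegative everywhere.\<close>

definition h :: "nat \<Rightarrow> 'm \<Rightarrow> real" where "h n \<omega> = enn2real (H n \<omega>)"

lemma measurable_h [measurable]: "h n \<in> borel_measurable M"
  unfolding h_def by measurable

lemma h_nonneg: "0 \<le> h n \<omega>"
  by (simp add: h_def)

text \<open>The path may be longer than the list of constrained holding times: the surplus ones get
  threshold 0, which is almost surely no constraint. A negative threshold is likewise vacuous, hence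
  the \<open>max 0\<close>; the value -1 is used below to express the absence of a
  constraint.\<close>

lemma emeasure_path_h:
  assumes y: "\<And>k. k \<le> m \<Longrightarrow> y k \<in> S" and "n \<le> m"
  shows "emeasure M {\<omega> \<in> path_event y m. \<forall>k\<le>n. s k < h k \<omega>} =
    ennreal (path_prob y m * (\<Prod>k\<le>n. exp (- r (y k) * max 0 (s k))))"
proof -
  define s' where "s' k = (if k \<le> n then max 0 (s k) else 0)" for k
  have "emeasure M {\<omega> \<in> path_event y m. \<forall>k\<le>n. s k < h k \<omega>} =
    emeasure M {\<omega> \<in> space M. \<forall>k\<le>m. Y k \<omega> = y k \<and> ennreal (s' k) < H k \<omega>}"
  proof (rule emeasure_eq_AE)
    show "AE \<omega> in M. \<omega> \<in> {\<omega> \<in> path_event y m. \<forall>k\<le>n. s k < h k \<omega>} \<longleftrightarrow>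
      \<omega> \<in> {\<omega> \<in> space M. \<forall>k\<le>m. Y k \<omega> = y k \<and> ennreal (s' k) < H k \<omega>}"
      using AE_holding_time_pos AE_holding_time_finite AE_space
    proof eventually_elim
      case (elim \<omega>)
      have H: "H k \<omega> = ennreal (h k \<omega>)" "0 < h k \<omega>" for k
        using elim by (simp_all add: h_def less_top enn2real_positive_iff)
      show ?case
        using \<open>n \<le> m\<close> H(2) h_nonneg elim(3)
        by (auto simp: path_event_def s'_def H(1) ennreal_less_iff)
    qed
  next
    have "{\<omega> \<in> path_event y m. \<forall>k\<le>n. s k < h k \<omega>} = {\<omega> \<in> space M. \<omega> \<in> path_event y m \<and> (\<forall>k\<le>n. s k < h k \<omega>)}"
      by (auto simp: path_event_def)
    also have "\<dots> \<in> sets M" by measurable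
    finally show "{\<omega> \<in> path_event y m. \<forall>k\<le>n. s k < h k \<omega>} \<in> sets M" .
  qed measurable
  also have "\<dots> = ennreal (path_prob y m * (\<Prod>k\<le>m. exp (- r (y k) * s' k)))"
    by (rule emeasure_law) (auto simp: y s'_def)
  also have "(\<Prod>k\<le>m. exp (- r (y k) * s' k)) = (\<Prod>k\<le>n. exp (- r (y k) * s' k))"
    by (rule prod.mono_neutral_right) (use \<open>n \<le> m\<close> in \<open>auto simp: s'_def\<close>)
  also have "\<dots> = (\<Prod>k\<le>n. exp (- r (y k) * max 0 (s k)))"
    by (rule prod.cong) (auto simp: s'_def)
  finally show ?thesis .
qed

lemma emeasure_path_event:
  assumes "\<And>k. k \<le> m \<Longrightarrow> y k \<in> S"
  shows "emeasure M (path_event y m) = ennreal (path_prob y m)"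
proof -
  have "emeasure M (path_event y m) = emeasure M {\<omega> \<in> path_event y m. \<forall>k\<le>m. -1 < h k \<omega>}"
    by (intro arg_cong[where f="emeasure M"]) (auto intro: less_le_trans[OF _ h_nonneg])
  then show ?thesis
    by (subst (asm) emeasure_path_h) (auto simp: assms)
qed

text \<open>Conditionally on a path the holding times are independent exponentials. The case
  \<open>n < m\<close> lets the path run beyond the holding times that are integrated, as is needed
  for a jump whose target is also prescribed.\<close>

lemma nn_integral_path:
  assumes y: "\<And>k. k \<le> m \<Longrightarrow> y k \<in> S" and nm: "n \<le> m"
    and \<phi>[measurable]: "\<phi> \<in> borel_measurable (\<Pi>\<^sub>M i\<in>{..n}. borel)"
  shows "(\<integral>\<^sup>+\<omega>. \<phi> (\<lambda>k\<in>{..n}. h k \<omega>) * indicator (path_event y m) \<omega> \<partial>M)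
    = ennreal (path_prob y m) * (\<integral>\<^sup>+v. \<phi> v \<partial>(\<Pi>\<^sub>M i\<in>{..n}. exponential (r (y i))))"
\<comment> \<open>Conditioning on the path requires positive probability, so null paths are treated
  separately; both sides vanish there.\<close>
proof (cases "path_prob y m = 0")
  case True
  then have "AE \<omega> in M. \<omega> \<notin> path_event y m"
    by (intro AE_not_in null_setsI) (simp_all add: emeasure_path_event y)
  then have "(\<integral>\<^sup>+\<omega>. \<phi> (\<lambda>k\<in>{..n}. h k \<omega>) * indicator (path_event y m) \<omega> \<partial>M) = (\<integral>\<^sup>+\<omega>. 0 \<partial>M)"
    by (intro nn_integral_cong_AE) (auto elim!: eventually_mono)
  then show ?thesis using True by simp
next
  case False
  let ?C = "path_prob y m"
  let ?A = "path_event y m"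
  have C: "0 < ?C"
    using False path_prob_nonneg[of m y] y by fastforce
  define M' where "M' = uniform_measure M ?A"
  have emA: "emeasure M ?A = ennreal ?C" by (rule emeasure_path_event) (rule y)
  interpret M': prob_space M'
    unfolding M'_def using C by (intro prob_space_uniform_measure) (simp_all add: emA)
  have sets_M': "sets M' = sets M" and space_M': "space M' = space M"
    by (simp_all add: M'_def)
  note [measurable_cong] = sets_M'
  have M'_prob: "M'.prob {\<omega> \<in> space M'. \<forall>k\<le>n. s k < h k \<omega>} = (\<Prod>k\<le>n. exp (- r (y k) * max 0 (s k)))"
    for s :: "nat \<Rightarrow> real"
  proof -
    have "emeasure M' {\<omega> \<in> space M'. \<forall>k\<le>n. s k < h k \<omega>}
      = emeasure M (?A \<inter> {\<omega> \<in> space M. \<forall>k\<le>n. s k < h k \<omega>}) / emeasure M ?A"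
      unfolding M'_def by (subst emeasure_uniform_measure) auto
    also have "?A \<inter> {\<omega> \<in> space M. \<forall>k\<le>n. s k < h k \<omega>} = {\<omega> \<in> ?A. \<forall>k\<le>n. s k < h k \<omega>}"
      by (auto simp: path_event_def)
    also have "emeasure M \<dots> / emeasure M ?A
      = ennreal ((?C * (\<Prod>k\<le>n. exp (- r (y k) * max 0 (s k)))) / ?C)"
      using C by (subst emeasure_path_h) (auto simp: y nm emA divide_ennreal prod_nonneg)
    finally show ?thesis
      using C by (simp add: measure_def prod_nonneg)
  qed
  have single: "M'.prob {\<omega> \<in> space M'. a < h j \<omega>} = exp (- r (y j) * max 0 a)" if "j \<le> n" for j a
  proof -
    have "M'.prob {\<omega> \<in> space M'. a < h j \<omega>} =
      M'.prob {\<omega> \<in> space M'. \<forall>k\<le>n. (if k = j then a else - 1) < h k \<omega>}"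
      using that by (intro arg_cong[where f="M'.prob"]) (auto intro: less_le_trans[OF _ h_nonneg])
    also have "\<dots> = (\<Prod>k\<le>n. if k = j then exp (- r (y j) * max 0 a) else 1)"
      unfolding M'_prob by (intro prod.cong) auto
    finally show ?thesis using that by simp
  qed
  have distr_h: "distr M' borel (h j) = exponential (r (y j))" if "j \<le> n" for j
    using that y[of j] nm single[OF that]
    by (intro M'.distr_exponentialI exit_rate_pos) auto
  \<comment> \<open>The half-lines and the whole line form an intersection-stable generator of the
    Borel sets, so independence reduces to the product formula for joint tails, which is
    \<open>M'_prob\<close>.\<close>
  let ?E = "insert UNIV (range greaterThan) :: real set set"
  have "M'.indep_vars (\<lambda>_. borel) h {..n}"
  proof (subst M'.indep_vars_finite[where E="\<lambda>_. ?E"])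
    show "sets borel = sigma_sets (space borel) ?E"
    proof -
      have "(borel :: real measure) = sigma UNIV ?E"
        by (rule borel_eq_sigmaI1[OF borel_Ioi, where F="\<lambda>x. x" and A="?E", simplified]) auto
      then show ?thesis by (metis sets_measure_of space_borel top_greatest Pow_UNIV)
    qed
    have "{a::real <..} \<inter> {b<..} = {max a b <..}" for a b by auto
    then show "Int_stable ?E" by (auto simp: Int_stable_def)
    show "\<forall>A\<in>{..n} \<rightarrow> ?E. M'.prob (\<Inter>j\<in>{..n}. h j -` A j \<inter> space M')
        = (\<Prod>j\<in>{..n}. M'.prob (h j -` A j \<inter> space M'))"
    proof
      fix A assume A: "A \<in> {..n} \<rightarrow> ?E"
      \<comment> \<open>The whole line is represented by the threshold -1, which \<open>h\<close>
        always exceeds.\<close>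
      define s where "s j = (if A j = UNIV then - 1 else SOME a. A j = {a <..})" for j
      have s: "h j -` A j \<inter> space M' = {\<omega> \<in> space M'. s j < h j \<omega>}" if "j \<le> n" for j
      proof (cases "A j = UNIV")
        case True
        then show ?thesis by (auto simp: s_def intro: less_le_trans[OF _ h_nonneg])
      next
        case False
        then have "\<exists>a. A j = {a <..}" using A that by (auto simp: Pi_iff)
        then have "A j = {SOME a. A j = {a <..} <..}" by (rule someI_ex)
        with False have "A j = {s j <..}" by (simp add: s_def)
        then show ?thesis by auto
      qed
      have "(\<Inter>j\<in>{..n}. h j -` A j \<inter> space M') = (\<Inter>j\<in>{..n}. {\<omega> \<in> space M'. s j < h j \<omega>})"
        by (intro INF_cong) (auto simp: s)
      also have "\<dots> = {\<omega> \<in> space M'. \<forall>k\<le>n. s k < h k \<omega>}" by auto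
      finally show "M'.prob (\<Inter>j\<in>{..n}. h j -` A j \<inter> space M')
        = (\<Prod>j\<in>{..n}. M'.prob (h j -` A j \<inter> space M'))"
        by (simp add: M'_prob s single)
    qed
  qed auto
  then have D: "distr M' (\<Pi>\<^sub>M i\<in>{..n}. borel) (\<lambda>\<omega>. \<lambda>i\<in>{..n}. h i \<omega>)
      = (\<Pi>\<^sub>M i\<in>{..n}. distr M' borel (h i))"
    by (subst (asm) M'.indep_vars_iff_distr_eq_PiM) auto
  also have "\<dots> = (\<Pi>\<^sub>M i\<in>{..n}. exponential (r (y i)))"
    by (intro PiM_cong) (auto simp: distr_h)
  finally have D: "distr M' (\<Pi>\<^sub>M i\<in>{..n}. borel) (\<lambda>\<omega>. \<lambda>i\<in>{..n}. h i \<omega>)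
      = (\<Pi>\<^sub>M i\<in>{..n}. exponential (r (y i)))" .
  have "(\<integral>\<^sup>+v. \<phi> v \<partial>(\<Pi>\<^sub>M i\<in>{..n}. exponential (r (y i)))) = (\<integral>\<^sup>+\<omega>. \<phi> (\<lambda>i\<in>{..n}. h i \<omega>) \<partial>M')"
    unfolding D[symmetric] by (subst nn_integral_distr) auto
  also have "\<dots> = (\<integral>\<^sup>+\<omega>. \<phi> (\<lambda>k\<in>{..n}. h k \<omega>) * indicator ?A \<omega> \<partial>M) / ennreal ?C"
    unfolding M'_def by (subst nn_integral_uniform_measure) (auto simp: emA)
  finally show ?thesis
    using C by (simp add: ennreal_times_divide mult.commute[of "ennreal ?C"] mult_divide_eq_ennreal
      flip: ennreal_0)
qed

definition jump_time :: "nat \<Rightarrow> 'm \<Rightarrow> real" where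
  "jump_time n \<omega> = (\<Sum>k<n. h k \<omega>)"

lemma measurable_jump_time [measurable]: "jump_time n \<in> borel_measurable M"
  unfolding jump_time_def by measurable

text \<open>On a fixed path \<open>jump_time n\<close> depends only on the holding times before
  \<open>h n\<close>, so \<open>h n\<close> can be integrated out on its own, while prescribing one
  more state costs one transition probability.\<close>

lemma nn_integral_path_step:
  assumes y: "\<And>k. k \<le> Suc n \<Longrightarrow> y k \<in> S"
    and \<phi>[measurable]: "case_prod \<phi> \<in> borel_measurable (borel \<Otimes>\<^sub>M borel)"
  shows "(\<integral>\<^sup>+\<omega>. \<phi> (jump_time n \<omega>) (h n \<omega>) * indicator (path_event y (Suc n)) \<omega> \<partial>M)
    = ennreal (p (y n) (y (Suc n))) *
      (\<integral>\<^sup>+\<omega>. (\<integral>\<^sup>+e. \<phi> (jump_time n \<omega>) e \<partial>exponential (r (y n)))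
        * indicator (path_event y n) \<omega> \<partial>M)"
proof -
  \<comment> \<open>The path is continued by \<open>y 0\<close> so that every index carries a
    probability measure, as the product of measures demands; the values up to \<open>Suc n\<close>
    are unchanged.\<close>
  define y' where "y' k = (if k \<le> Suc n then y k else y 0)" for k
  have y': "y' k \<in> S" for k using y by (auto simp: y'_def)
  interpret P: product_sigma_finite "\<lambda>k. exponential (r (y' k))"
    by (intro product_sigma_finite.intro prob_space_imp_sigma_finite prob_space_exponential
        exit_rate_pos y')
  interpret E: prob_space "exponential (r (y' n))"
    by (intro prob_space_exponential exit_rate_pos y')
  let ?P = "\<lambda>I. \<Pi>\<^sub>M i\<in>I. exponential (r (y' i))"
  have Py: "(\<Pi>\<^sub>M i\<in>{..n}. exponential (r (y i))) = ?P {..n}"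
    by (intro PiM_cong) (auto simp: y'_def)
  have ins: "{..n} = insert n {..<n}" by auto
  have [measurable]: "(\<lambda>x. \<integral>\<^sup>+e. \<phi> x e \<partial>exponential (r (y' n))) \<in> borel_measurable borel"
    by measurable
  have product: "(\<integral>\<^sup>+\<omega>. \<psi> (jump_time n \<omega>) (h n \<omega>) * indicator (path_event y m) \<omega> \<partial>M)
    = ennreal (path_prob y m) *
      (\<integral>\<^sup>+v. (\<integral>\<^sup>+e. \<psi> (\<Sum>k<n. v k) e \<partial>exponential (r (y' n))) \<partial>?P {..<n})"
    if [measurable]: "case_prod \<psi> \<in> borel_measurable (borel \<Otimes>\<^sub>M borel)"
      and m: "n \<le> m" "m \<le> Suc n" for \<psi> :: "real \<Rightarrow> real \<Rightarrow> ennreal" and m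
  proof -
    let ?\<psi> = "\<lambda>v. \<psi> (\<Sum>k<n. v k) (v n)"
    have meas: "?\<psi> \<in> borel_measurable (\<Pi>\<^sub>M i\<in>{..n}. borel)"
      by measurable
    have "(\<integral>\<^sup>+\<omega>. \<psi> (jump_time n \<omega>) (h n \<omega>) * indicator (path_event y m) \<omega> \<partial>M) =
      (\<integral>\<^sup>+\<omega>. ?\<psi> (\<lambda>k\<in>{..n}. h k \<omega>) * indicator (path_event y m) \<omega> \<partial>M)"
      by (simp add: jump_time_def)
    also have "\<dots> = ennreal (path_prob y m) * (\<integral>\<^sup>+v. ?\<psi> v \<partial>?P {..n})"
      using m by (subst nn_integral_path[OF _ _ meas]) (auto simp: y Py)
    also have "(\<integral>\<^sup>+v. ?\<psi> v \<partial>?P {..n})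
        = (\<integral>\<^sup>+v. (\<integral>\<^sup>+e. ?\<psi> (v(n := e)) \<partial>exponential (r (y' n))) \<partial>?P {..<n})"
      unfolding ins by (subst P.product_nn_integral_insert) auto
    finally show ?thesis by simp
  qed
  \<comment> \<open>\<open>product\<close> is used twice: with \<open>m = Suc n\<close> for
    \<open>\<phi>\<close>, and with \<open>m = n\<close> for \<open>\<phi>\<close> already
    integrated over its second argument. In the latter case the inner integral is of a constant and
    mass one returns it. The two path probabilities differ by the transition factor.\<close>
  have "ennreal (path_prob y (Suc n)) = ennreal (p (y n) (y (Suc n))) * ennreal (path_prob y n)"
    by (simp add: path_prob_Suc ennreal_mult path_prob_nonneg p_nonneg y mult.commute)
  moreover have yn: "y' n = y n" by (simp add: y'_def)
  moreover have "emeasure (exponential (r (y n))) UNIV = 1"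
    using E.emeasure_space_1 yn by simp
  moreover have "case_prod (\<lambda>x _. \<integral>\<^sup>+e. \<phi> x e \<partial>exponential (r (y' n))) \<in> borel_measurable (borel \<Otimes>\<^sub>M borel)"
    by measurable
  note product[OF this order_refl]
  ultimately show ?thesis
    using product[OF \<phi>, of "Suc n"] by (simp add: mult.assoc)
qed

section \<open>One-step recursion for state and jump time\<close>

lemma nn_integral_split_state:
  assumes [measurable]: "g \<in> borel_measurable M"
  shows "(\<integral>\<^sup>+\<omega>. g \<omega> \<partial>M)
    = (\<integral>\<^sup>+x. (\<integral>\<^sup>+\<omega>. (if Y n \<omega> = x then g \<omega> else 0) \<partial>M) \<partial>count_space S)"
proof -
  have "(\<integral>\<^sup>+\<omega>. g \<omega> \<partial>M) = (\<integral>\<^sup>+\<omega>. (\<integral>\<^sup>+x. (if Y n \<omega> = x then g \<omega> else 0) \<partial>count_space S) \<partial>M)"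
  proof (intro nn_integral_cong)
    fix \<omega> assume "\<omega> \<in> space M"
    have "(\<integral>\<^sup>+x. (if Y n \<omega> = x then g \<omega> else 0) \<partial>count_space S)
        = (\<integral>\<^sup>+x. g \<omega> * indicator {Y n \<omega>} x \<partial>count_space S)"
      by (intro nn_integral_cong) (auto simp: indicator_def)
    also have "\<dots> = g \<omega>"
      using Y_in_S[OF \<open>\<omega> \<in> space M\<close>] by (simp add: nn_integral_cmult)
    finally show "g \<omega> = (\<integral>\<^sup>+x. (if Y n \<omega> = x then g \<omega> else 0) \<partial>count_space S)" ..
  qed
  also have "\<dots> = (\<integral>\<^sup>+x. (\<integral>\<^sup>+\<omega>. (if Y n \<omega> = x then g \<omega> else 0) \<partial>M) \<partial>count_space S)"
    by (intro nn_integral_count_space_nn_integral countable_S) measurable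
  finally show ?thesis .
qed

lemma nn_integral_split_paths:
  assumes [measurable]: "g \<in> borel_measurable M"
  shows "(\<integral>\<^sup>+\<omega>. g \<omega> \<partial>M)
    = (\<integral>\<^sup>+y. (\<integral>\<^sup>+\<omega>. g \<omega> * indicator (path_event y n) \<omega> \<partial>M) \<partial>count_space (PiE {..n} (\<lambda>_. S)))"
proof -
  have "(\<integral>\<^sup>+\<omega>. g \<omega> \<partial>M) = (\<integral>\<^sup>+\<omega>. (\<integral>\<^sup>+y. g \<omega> * indicator (path_event y n) \<omega>
      \<partial>count_space (PiE {..n} (\<lambda>_. S))) \<partial>M)"
  proof (intro nn_integral_cong)
    fix \<omega> assume \<omega>: "\<omega> \<in> space M"
    let ?y = "\<lambda>k\<in>{..n}. Y k \<omega>"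
    have y: "?y \<in> PiE {..n} (\<lambda>_. S)"
      using Y_in_S[OF \<omega>] by auto
    have *: "\<omega> \<in> path_event y n \<longleftrightarrow> y = ?y" if "y \<in> PiE {..n} (\<lambda>_. S)" for y
      using that \<omega> by (auto simp: path_event_def fun_eq_iff PiE_def extensional_def)
    have "(\<integral>\<^sup>+y. g \<omega> * indicator (path_event y n) \<omega> \<partial>count_space (PiE {..n} (\<lambda>_. S)))
        = (\<integral>\<^sup>+y. g \<omega> * indicator {?y} y \<partial>count_space (PiE {..n} (\<lambda>_. S)))"
      by (intro nn_integral_cong) (simp add: indicator_def *)
    also have "\<dots> = g \<omega>"
      using y by (simp add: nn_integral_cmult)
    finally show "g \<omega> = (\<integral>\<^sup>+y. g \<omega> * indicator (path_event y n) \<omega>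
      \<partial>count_space (PiE {..n} (\<lambda>_. S)))" ..
  qed
  also have "\<dots> = (\<integral>\<^sup>+y. (\<integral>\<^sup>+\<omega>. g \<omega> * indicator (path_event y n) \<omega> \<partial>M) \<partial>count_space (PiE {..n} (\<lambda>_. S)))"
    by (intro nn_integral_count_space_nn_integral countable_PiE countable_S) auto
  finally show ?thesis .
qed

lemma measurable_initial_weight [measurable]: "(\<lambda>\<omega>. (b (Y 0 \<omega>) :: ennreal)) \<in> borel_measurable M"
  by (rule measurable_compose[OF measurable_jump_chain]) simp

text \<open>
  The weight \<open>b\<close> of the initial state is \<open>1\<close> for the law of the chain and \<open>1 / u\<close> for
  non-explosion, where it makes a moment assumption on the initial law unnecessary.
\<close>
definition state_integral :: "('s \<Rightarrow> ennreal) \<Rightarrow> nat \<Rightarrow> 's \<Rightarrow> (real \<Rightarrow> ennreal) \<Rightarrow> ennreal" where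
  "state_integral b n x \<psi> =
    (\<integral>\<^sup>+\<omega>. \<psi> (jump_time n \<omega>) * (if Y n \<omega> = x then b (Y 0 \<omega>) else 0) \<partial>M)"

text \<open>The one-step Markov property, obtained by summing \<open>nn_integral_path_step\<close>
  over all paths up to \<open>n\<close>. On each path the weight \<open>b (Y 0 \<omega>)\<close> is
  the constant \<open>b (y 0)\<close> and moves out of the integral; paths not ending in
  \<open>x\<close> contribute nothing.\<close>

lemma nn_integral_step:
  assumes x: "x \<in> S" and z: "z \<in> S"
    and \<phi>[measurable]: "case_prod \<phi> \<in> borel_measurable (borel \<Otimes>\<^sub>M borel)"
  shows "(\<integral>\<^sup>+\<omega>. \<phi> (jump_time n \<omega>) (h n \<omega>) *
      (if Y n \<omega> = x \<and> Y (Suc n) \<omega> = z then b (Y 0 \<omega>) else 0) \<partial>M)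
    = ennreal (p x z) * state_integral b n x (\<lambda>s. \<integral>\<^sup>+e. \<phi> s e \<partial>exponential (r x))"
proof -
  interpret E: prob_space "exponential (r x)"
    by (intro prob_space_exponential exit_rate_pos x)
  have [measurable]: "(\<lambda>s. \<integral>\<^sup>+e. \<phi> s e \<partial>exponential (r x)) \<in> borel_measurable borel"
    by measurable
  let ?I = "count_space (PiE {..n} (\<lambda>_. S))"
  have "(\<integral>\<^sup>+\<omega>. \<phi> (jump_time n \<omega>) (h n \<omega>) *
      (if Y n \<omega> = x \<and> Y (Suc n) \<omega> = z then b (Y 0 \<omega>) else 0) \<partial>M)
    = (\<integral>\<^sup>+y. (\<integral>\<^sup>+\<omega>. \<phi> (jump_time n \<omega>) (h n \<omega>) *
      (if Y n \<omega> = x \<and> Y (Suc n) \<omega> = z then b (Y 0 \<omega>) else 0) * indicator (path_event y n) \<omega> \<partial>M) \<partial>?I)"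
    by (rule nn_integral_split_paths) measurable
  also have "\<dots> = (\<integral>\<^sup>+y. ennreal (p x z) * (\<integral>\<^sup>+\<omega>. (\<integral>\<^sup>+e. \<phi> (jump_time n \<omega>) e \<partial>exponential (r x))
      * (if Y n \<omega> = x then b (Y 0 \<omega>) else 0) * indicator (path_event y n) \<omega> \<partial>M) \<partial>?I)"
  proof (intro nn_integral_cong)
    fix y assume "y \<in> space ?I"
    then have y: "y k \<in> S" if "k \<le> n" for k using that by auto
    let ?y = "y(Suc n := z)"
    show "(\<integral>\<^sup>+\<omega>. \<phi> (jump_time n \<omega>) (h n \<omega>) *
      (if Y n \<omega> = x \<and> Y (Suc n) \<omega> = z then b (Y 0 \<omega>) else 0) * indicator (path_event y n) \<omega> \<partial>M)
     = ennreal (p x z) * (\<integral>\<^sup>+\<omega>. (\<integral>\<^sup>+e. \<phi> (jump_time n \<omega>) e \<partial>exponential (r x))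
      * (if Y n \<omega> = x then b (Y 0 \<omega>) else 0) * indicator (path_event y n) \<omega> \<partial>M)"
      (is "?L = ennreal (p x z) * ?R")
    proof (cases "y n = x")
      case True
      have "?L = (\<integral>\<^sup>+\<omega>. b (y 0) * (\<phi> (jump_time n \<omega>) (h n \<omega>) * indicator (path_event ?y (Suc n)) \<omega>) \<partial>M)"
        using True by (intro nn_integral_cong)
          (auto simp: path_event_def indicator_def le_Suc_eq mult.commute)
      also have "\<dots> = b (y 0) * (\<integral>\<^sup>+\<omega>. \<phi> (jump_time n \<omega>) (h n \<omega>) * indicator (path_event ?y (Suc n)) \<omega> \<partial>M)"
        by (rule nn_integral_cmult) measurable
      also have "\<dots> = b (y 0) * (ennreal (p (?y n) (?y (Suc n))) *
         (\<integral>\<^sup>+\<omega>. (\<integral>\<^sup>+e. \<phi> (jump_time n \<omega>) e \<partial>exponential (r (?y n))) * indicator (path_event ?y n) \<omega> \<partial>M))"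
        by (subst nn_integral_path_step) (use y z in \<open>auto simp: le_Suc_eq\<close>)
      also have "path_event ?y n = path_event y n"
        by (auto simp: path_event_def)
      also have "b (y 0) * (ennreal (p (?y n) (?y (Suc n))) *
         (\<integral>\<^sup>+\<omega>. (\<integral>\<^sup>+e. \<phi> (jump_time n \<omega>) e \<partial>exponential (r (?y n))) * indicator (path_event y n) \<omega> \<partial>M))
        = ennreal (p x z) * (b (y 0) *
          (\<integral>\<^sup>+\<omega>. (\<integral>\<^sup>+e. \<phi> (jump_time n \<omega>) e \<partial>exponential (r x)) * indicator (path_event y n) \<omega> \<partial>M))"
        using True by (simp add: mult_ac)
      also have "b (y 0) *
          (\<integral>\<^sup>+\<omega>. (\<integral>\<^sup>+e. \<phi> (jump_time n \<omega>) e \<partial>exponential (r x)) * indicator (path_event y n) \<omega> \<partial>M)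
         = (\<integral>\<^sup>+\<omega>. b (y 0) *
          ((\<integral>\<^sup>+e. \<phi> (jump_time n \<omega>) e \<partial>exponential (r x)) * indicator (path_event y n) \<omega>) \<partial>M)"
        by (rule nn_integral_cmult[symmetric]) measurable
      also have "\<dots> = ?R"
        using True by (intro nn_integral_cong) (auto simp: path_event_def indicator_def mult.commute)
      finally show ?thesis .
    next
      case False
      have "?L = (\<integral>\<^sup>+\<omega>. 0 \<partial>M)"
        using False by (intro nn_integral_cong) (auto simp: path_event_def indicator_def)
      moreover have "?R = (\<integral>\<^sup>+\<omega>. 0 \<partial>M)"
        using False by (intro nn_integral_cong) (auto simp: path_event_def indicator_def)
      ultimately show ?thesis by simp
    qed
  qed
  also have "\<dots> = ennreal (p x z) * (\<integral>\<^sup>+y. (\<integral>\<^sup>+\<omega>. (\<integral>\<^sup>+e. \<phi> (jump_time n \<omega>) e \<partial>exponential (r x))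
      * (if Y n \<omega> = x then b (Y 0 \<omega>) else 0) * indicator (path_event y n) \<omega> \<partial>M) \<partial>?I)"
    by (rule nn_integral_cmult) simp
  also have "(\<integral>\<^sup>+y. (\<integral>\<^sup>+\<omega>. (\<integral>\<^sup>+e. \<phi> (jump_time n \<omega>) e \<partial>exponential (r x))
      * (if Y n \<omega> = x then b (Y 0 \<omega>) else 0) * indicator (path_event y n) \<omega> \<partial>M) \<partial>?I)
    = state_integral b n x (\<lambda>s. \<integral>\<^sup>+e. \<phi> s e \<partial>exponential (r x))"
    unfolding state_integral_def by (rule nn_integral_split_paths[symmetric]) measurable
  finally show ?thesis .
qed

text \<open>Follows from \<open>nn_integral_step\<close> by summing over the next state
  \<open>z\<close>, since the transition probabilities from \<open>x\<close> add up to one.\<close>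

lemma nn_integral_holding_time:
  assumes x: "x \<in> S" and \<phi>[measurable]: "case_prod \<phi> \<in> borel_measurable (borel \<Otimes>\<^sub>M borel)"
  shows "(\<integral>\<^sup>+\<omega>. \<phi> (jump_time n \<omega>) (h n \<omega>) * (if Y n \<omega> = x then b (Y 0 \<omega>) else 0) \<partial>M)
    = state_integral b n x (\<lambda>s. \<integral>\<^sup>+e. \<phi> s e \<partial>exponential (r x))"
proof -
  have "(\<integral>\<^sup>+\<omega>. \<phi> (jump_time n \<omega>) (h n \<omega>) * (if Y n \<omega> = x then b (Y 0 \<omega>) else 0) \<partial>M)
    = (\<integral>\<^sup>+z. (\<integral>\<^sup>+\<omega>. (if Y (Suc n) \<omega> = z then \<phi> (jump_time n \<omega>) (h n \<omega>) *
        (if Y n \<omega> = x then b (Y 0 \<omega>) else 0) else 0) \<partial>M) \<partial>count_space S)"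
    by (rule nn_integral_split_state) measurable
  also have "\<dots> = (\<integral>\<^sup>+z. ennreal (p x z) *
      state_integral b n x (\<lambda>s. \<integral>\<^sup>+e. \<phi> s e \<partial>exponential (r x)) \<partial>count_space S)"
    using x by (intro nn_integral_cong, subst nn_integral_step[symmetric])
      (auto intro!: nn_integral_cong)
  also have "\<dots> = state_integral b n x (\<lambda>s. \<integral>\<^sup>+e. \<phi> s e \<partial>exponential (r x))"
    by (simp add: nn_integral_multc nn_integral_jump_prob x)
  finally show ?thesis .
qed

text \<open>Decomposition according to the state \<open>x\<close> before the last jump; the new jump
  time is the old one plus an exponential time of rate \<open>r x\<close>.\<close>

lemma state_integral_Suc:
  assumes z: "z \<in> S" and \<psi>[measurable]: "\<psi> \<in> borel_measurable borel"
  shows "state_integral b (Suc n) z \<psi> =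
    (\<integral>\<^sup>+x. ennreal (p x z) * state_integral b n x (\<lambda>s. \<integral>\<^sup>+e. \<psi> (s + e) \<partial>exponential (r x))
      \<partial>count_space S)"
proof -
  have "state_integral b (Suc n) z \<psi> = (\<integral>\<^sup>+x. (\<integral>\<^sup>+\<omega>. (if Y n \<omega> = x then
      \<psi> (jump_time (Suc n) \<omega>) * (if Y (Suc n) \<omega> = z then b (Y 0 \<omega>) else 0) else 0) \<partial>M) \<partial>count_space S)"
    unfolding state_integral_def by (rule nn_integral_split_state) measurable
  also have "\<dots> = (\<integral>\<^sup>+x. ennreal (p x z) *
      state_integral b n x (\<lambda>s. \<integral>\<^sup>+e. \<psi> (s + e) \<partial>exponential (r x)) \<partial>count_space S)"
    using z by (intro nn_integral_cong, subst nn_integral_step[symmetric])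
      (auto intro!: nn_integral_cong simp: jump_time_def)
  finally show ?thesis .
qed

section \<open>Occupation probabilities and comparison with the forward equation\<close>

lemma jump_time_nonneg: "0 \<le> jump_time n \<omega>"
  by (simp add: jump_time_def sum_nonneg h_nonneg)

text \<open>The contribution of exactly \<open>n\<close> jumps to the probability of being in
  \<open>x\<close> at time \<open>t\<close>. Summed over \<open>n\<close> it gives the minimal
  nonnegative solution of the forward equation.\<close>

definition occupation :: "nat \<Rightarrow> real \<Rightarrow> 's \<Rightarrow> ennreal" where
  "occupation n t x =
    emeasure M {\<omega> \<in> space M. Y n \<omega> = x \<and> jump_time n \<omega> \<le> t \<and> t < jump_time (Suc n) \<omega>}"

text \<open>If the \<open>n\<close>-th jump occurs at time \<open>s\<close>, the following holding
  time has to exceed \<open>t - s\<close>, which gives the exponential tail.\<close>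

lemma occupation_eq:
  assumes x: "x \<in> S"
  shows "occupation n t x = state_integral (\<lambda>_. 1) n x
    (\<lambda>s. if s \<le> t then ennreal (exp (- r x * (t - s))) else 0)"
proof -
  let ?\<phi> = "\<lambda>s e. indicator {..t} s * indicator {e. t < s + e} e :: ennreal"
  have "occupation n t x = (\<integral>\<^sup>+\<omega>. indicator
      {\<omega> \<in> space M. Y n \<omega> = x \<and> jump_time n \<omega> \<le> t \<and> t < jump_time (Suc n) \<omega>} \<omega> \<partial>M)"
    unfolding occupation_def by (rule nn_integral_indicator[symmetric]) measurable
  also have "\<dots> = (\<integral>\<^sup>+\<omega>. ?\<phi> (jump_time n \<omega>) (h n \<omega>) * (if Y n \<omega> = x then 1 else 0) \<partial>M)"
    by (intro nn_integral_cong) (auto simp: jump_time_def indicator_def)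
  also have "\<dots> = state_integral (\<lambda>_. 1) n x (\<lambda>s. \<integral>\<^sup>+e. ?\<phi> s e \<partial>exponential (r x))"
    using x by (rule nn_integral_holding_time) measurable
  also have "(\<lambda>s. \<integral>\<^sup>+e. ?\<phi> s e \<partial>exponential (r x)) =
    (\<lambda>s. if s \<le> t then ennreal (exp (- r x * (t - s))) else 0)"
  proof
    fix s
    have "{e. t < s + e} = {t - s <..}" by auto
    then show "(\<integral>\<^sup>+e. ?\<phi> s e \<partial>exponential (r x)) =
        (if s \<le> t then ennreal (exp (- r x * (t - s))) else 0)"
      using emeasure_exponential_greaterThan[OF exit_rate_pos[OF x], of "t - s"]
      by (cases "s \<le> t") (auto simp: nn_integral_cmult)
  qed
  finally show ?thesis .
qed

lemma measurable_occupation [measurable]: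
  assumes "x \<in> S" shows "(\<lambda>t. occupation n t x) \<in> borel_measurable borel"
  unfolding occupation_eq[OF assms] state_integral_def by measurable

lemma occupation_0:
  assumes x: "x \<in> S" and t: "0 \<le> t"
  shows "occupation 0 t x = ennreal (\<mu> x * exp (- r x * t))"
proof -
  have "occupation 0 t x = emeasure M {\<omega> \<in> path_event (\<lambda>_. x) 0. \<forall>k\<le>0. t < h k \<omega>}"
    unfolding occupation_def using t
    by (intro arg_cong[where f="emeasure M"]) (auto simp: path_event_def jump_time_def)
  then show ?thesis
    using t x by (subst (asm) emeasure_path_h) (auto simp: path_prob_def)
qed

text \<open>The integrated forward equation: the last jump leads from \<open>x\<close> to
  \<open>z\<close> at some time \<open>s\<close>, after which the chain stays in \<open>z\<close>
  until \<open>t\<close>. The jump rate arises as \<open>p x z * r x = q x z\<close>.\<close>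

lemma occupation_Suc:
  assumes z: "z \<in> S"
  shows "occupation (Suc n) t z = (\<integral>\<^sup>+x. ennreal (q x z) *
    (\<integral>\<^sup>+s. occupation n s x * ennreal (exp (- r z * (t - s))) * indicator {0..t} s \<partial>lborel)
      \<partial>count_space (S - {z}))"
proof -
  let ?\<psi> = "\<lambda>s. if s \<le> t then ennreal (exp (- r z * (t - s))) else 0"
  have "occupation (Suc n) t z = (\<integral>\<^sup>+x. ennreal (p x z) *
    state_integral (\<lambda>_. 1) n x (\<lambda>s. \<integral>\<^sup>+e. ?\<psi> (s + e) \<partial>exponential (r x)) \<partial>count_space S)"
    unfolding occupation_eq[OF z] using z by (rule state_integral_Suc) measurable
  also have "\<dots> = (\<integral>\<^sup>+x. ennreal (p x z) *
    state_integral (\<lambda>_. 1) n x (\<lambda>s. \<integral>\<^sup>+e. ?\<psi> (s + e) \<partial>exponential (r x)) \<partial>count_space (S - {z}))"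
    using exit_rate_pos[OF z] by (intro nn_integral_count_space_eq) (auto simp: jump_prob_def)
  also have "\<dots> = (\<integral>\<^sup>+x. ennreal (q x z) *
    (\<integral>\<^sup>+s. occupation n s x * ennreal (exp (- r z * (t - s))) * indicator {0..t} s \<partial>lborel)
      \<partial>count_space (S - {z}))"
  proof (intro nn_integral_cong)
    fix x assume "x \<in> space (count_space (S - {z}))"
    then have x: "x \<in> S" "x \<noteq> z" by auto
    note rx = exit_rate_pos[OF x(1)]
    let ?\<chi> = "\<lambda>u s. if s \<le> u then ennreal (exp (- r x * (u - s))) else 0"
    \<comment> \<open>Substituting \<open>u = s + e\<close> for the time of the next jump turns the
      exponential density into \<open>r x\<close> times the probability of staying in
      \<open>x\<close> from \<open>s\<close> to \<open>u\<close>. After exchanging integrals the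
      latter becomes \<open>occupation n u x\<close>.\<close>
    have shift: "(\<integral>\<^sup>+e. ?\<psi> (s + e) \<partial>exponential (r x))
        = (\<integral>\<^sup>+u. ennreal (r x) * (?\<chi> u s * ?\<psi> u) \<partial>lborel)" for s
    proof -
      have "(\<integral>\<^sup>+e. ?\<psi> (s + e) \<partial>exponential (r x))
          = (\<integral>\<^sup>+e. ennreal (exponential_density (r x) e) * ?\<psi> (s + e) \<partial>lborel)"
        by (rule nn_integral_exponential) measurable
      also have "\<dots> = (\<integral>\<^sup>+u. ennreal (exponential_density (r x) (u - s)) * ?\<psi> u \<partial>lborel)"
        by (subst nn_integral_real_affine[where c=1 and t="- s"]) (simp_all cong: if_cong)
      also have "\<dots> = (\<integral>\<^sup>+u. ennreal (r x) * (?\<chi> u s * ?\<psi> u) \<partial>lborel)"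
      proof (intro nn_integral_cong)
        fix u
        have "exponential_density (r x) (u - s) = (if s \<le> u then r x * exp (- r x * (u - s)) else 0)"
          by (simp add: exponential_density_def algebra_simps)
        then show "ennreal (exponential_density (r x) (u - s)) * ?\<psi> u
            = ennreal (r x) * (?\<chi> u s * ?\<psi> u)"
          using rx by (simp add: ennreal_mult mult_ac)
      qed
      finally show ?thesis .
    qed
    interpret pair_sigma_finite M lborel ..
    let ?w = "\<lambda>\<omega>. if Y n \<omega> = x then 1 else 0 :: ennreal"
    have "state_integral (\<lambda>_. 1) n x (\<lambda>s. \<integral>\<^sup>+e. ?\<psi> (s + e) \<partial>exponential (r x))
      = (\<integral>\<^sup>+\<omega>. (\<integral>\<^sup>+u. ennreal (r x) * (?\<chi> u (jump_time n \<omega>) * ?\<psi> u) \<partial>lborel) * ?w \<omega> \<partial>M)"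
      unfolding state_integral_def shift ..
    also have "\<dots> = (\<integral>\<^sup>+\<omega>. (\<integral>\<^sup>+u. ennreal (r x) * (?\<chi> u (jump_time n \<omega>) * ?w \<omega>) * ?\<psi> u \<partial>lborel) \<partial>M)"
      by (intro nn_integral_cong) (auto simp: mult_ac)
    also have "\<dots> = (\<integral>\<^sup>+u. (\<integral>\<^sup>+\<omega>. ennreal (r x) * (?\<chi> u (jump_time n \<omega>) * ?w \<omega>) * ?\<psi> u \<partial>M) \<partial>lborel)"
      by (rule Fubini'[symmetric]) measurable
    also have "\<dots> = (\<integral>\<^sup>+u. ennreal (r x) * (occupation n u x * ennreal (exp (- r z * (t - u))) * indicator {0..t} u) \<partial>lborel)"
    proof (intro nn_integral_cong)
      fix u :: real
      have "(\<integral>\<^sup>+\<omega>. ennreal (r x) * (?\<chi> u (jump_time n \<omega>) * ?w \<omega>) * ?\<psi> u \<partial>M)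
        = ennreal (r x) * (\<integral>\<^sup>+\<omega>. ?\<chi> u (jump_time n \<omega>) * ?w \<omega> \<partial>M) * ?\<psi> u"
        by (subst nn_integral_multc, measurable, subst nn_integral_cmult, measurable)
      also have "(\<integral>\<^sup>+\<omega>. ?\<chi> u (jump_time n \<omega>) * ?w \<omega> \<partial>M) = occupation n u x"
        unfolding occupation_eq[OF x(1)] state_integral_def ..
      also have "ennreal (r x) * occupation n u x * ?\<psi> u =
        ennreal (r x) * (occupation n u x * ennreal (exp (- r z * (t - u))) * indicator {0..t} u)"
      proof (cases "0 \<le> u")
        case True
        then show ?thesis by (auto simp: indicator_def mult_ac)
      next
        case False
        then have "\<not> jump_time n \<omega> \<le> u" for \<omega>
          using jump_time_nonneg[of n \<omega>] by linarith
        then have "occupation n u x = 0" by (simp add: occupation_def)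
        then show ?thesis by simp
      qed
      finally show "(\<integral>\<^sup>+\<omega>. ennreal (r x) * (?\<chi> u (jump_time n \<omega>) * ?w \<omega>) * ?\<psi> u \<partial>M) =
        ennreal (r x) * (occupation n u x * ennreal (exp (- r z * (t - u))) * indicator {0..t} u)" .
    qed
    also have "\<dots> = ennreal (r x) *
        (\<integral>\<^sup>+u. occupation n u x * ennreal (exp (- r z * (t - u))) * indicator {0..t} u \<partial>lborel)"
      by (intro nn_integral_cmult) (use x in auto)
    finally have "ennreal (p x z) * state_integral (\<lambda>_. 1) n x (\<lambda>s. \<integral>\<^sup>+e. ?\<psi> (s + e) \<partial>exponential (r x))
      = ennreal (p x z * r x) *
        (\<integral>\<^sup>+u. occupation n u x * ennreal (exp (- r z * (t - u))) * indicator {0..t} u \<partial>lborel)"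
      using rx p_nonneg[OF x(1) z] by (simp add: ennreal_mult mult.assoc)
    also have "p x z * r x = q x z"
      using rx x by (simp add: jump_prob_def)
    finally show "ennreal (p x z) * state_integral (\<lambda>_. 1) n x (\<lambda>s. \<integral>\<^sup>+e. ?\<psi> (s + e) \<partial>exponential (r x))
      = ennreal (q x z) *
        (\<integral>\<^sup>+u. occupation n u x * ennreal (exp (- r z * (t - u))) * indicator {0..t} u \<partial>lborel)" .
  qed
  finally show ?thesis .
qed

text \<open>With the integrating factor \<open>exp (r x * s)\<close>, the value \<open>f t x\<close>
  is the surviving initial mass plus an integral of \<open>D\<close>, and \<open>D\<close> dominates
  the inflow from \<open>f\<close>. Induction on \<open>n\<close> inserts the bound for at most
  \<open>n\<close> jumps into \<open>occupation_Suc\<close> and so bounds the contribution of one up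
  to \<open>n + 1\<close> jumps.\<close>

lemma sum_occupation_le:
  fixes f D :: "real \<Rightarrow> 's \<Rightarrow> real"
  assumes f_nonneg: "\<And>s x. 0 \<le> s \<Longrightarrow> x \<in> S \<Longrightarrow> 0 \<le> f s x"
    and f_0: "\<And>x. x \<in> S \<Longrightarrow> f 0 x = \<mu> x"
    and deriv: "\<And>s x. 0 \<le> s \<Longrightarrow> x \<in> S \<Longrightarrow>
      ((\<lambda>s. f s x) has_real_derivative D s x - r x * f s x) (at s)"
    and D_cont: "\<And>x. x \<in> S \<Longrightarrow> continuous_on UNIV (\<lambda>s. D s x)"
    and D_nonneg: "\<And>s x. 0 \<le> s \<Longrightarrow> x \<in> S \<Longrightarrow> 0 \<le> D s x"
    and inflow: "\<And>s x. 0 \<le> s \<Longrightarrow> x \<in> S \<Longrightarrow>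
      (\<integral>\<^sup>+y. ennreal (q y x) * ennreal (f s y) \<partial>count_space (S - {x})) \<le> ennreal (D s x)"
    and "0 \<le> t" "x \<in> S"
  shows "(\<Sum>k\<le>n. occupation k t x) \<le> ennreal (f t x)"
proof -
  \<comment> \<open>Without its inflow \<open>f\<close> would decay exactly like the probability of
    no jump. This is the base case, and it also makes the difference formed at the end of the
    induction step nonnegative.\<close>
  have lower: "\<mu> x * exp (- r x * t) \<le> f t x" if t: "0 \<le> t" and x: "x \<in> S" for t x
  proof -
    let ?F = "\<lambda>s. f s x * exp (r x * s)"
    have "?F 0 \<le> ?F t"
    proof (rule DERIV_nonneg_imp_nondecreasing[OF t])
      fix s :: real assume s: "0 \<le> s"
      have "(?F has_real_derivative D s x * exp (r x * s)) (at s)"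
        using s x by (auto intro!: derivative_eq_intros deriv simp: algebra_simps)
      then show "\<exists>y. (?F has_real_derivative y) (at s) \<and> 0 \<le> y"
        using D_nonneg[OF s x] by auto
    qed
    then show ?thesis
      using f_0[OF x] by (simp add: exp_minus field_simps)
  qed
  show ?thesis
    using \<open>0 \<le> t\<close> \<open>x \<in> S\<close>
  proof (induction n arbitrary: t x)
    case 0
    then show ?case
      using lower by (simp add: occupation_0 ennreal_leI)
  next
    case (Suc n)
    note x = \<open>x \<in> S\<close> and t = \<open>0 \<le> t\<close>
    let ?e = "\<lambda>s. ennreal (exp (- r x * (t - s))) * indicator {0..t} s"
    let ?C = "count_space (S - {x})"
    have C: "countable (S - {x})" using countable_S by auto
    have [measurable]: "(\<lambda>s. occupation k s y) \<in> borel_measurable borel" if "y \<in> S" for k y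
      using that by (rule measurable_occupation)
    let ?F = "\<lambda>s. f s x * exp (- r x * (t - s))"
    have [measurable]: "(\<lambda>s. D s x) \<in> borel_measurable borel"
      by (rule borel_measurable_continuous_onI[OF D_cont[OF x]])
    have "(\<Sum>k\<le>n. occupation (Suc k) t x) =
      (\<integral>\<^sup>+y. (\<Sum>k\<le>n. ennreal (q y x) * (\<integral>\<^sup>+s. occupation k s y * ?e s \<partial>lborel)) \<partial>?C)"
      by (subst nn_integral_sum) (simp_all add: occupation_Suc x mult.assoc)
    also have "\<dots> = (\<integral>\<^sup>+y. (\<integral>\<^sup>+s. ennreal (q y x) * (\<Sum>k\<le>n. occupation k s y) * ?e s \<partial>lborel) \<partial>?C)"
    proof (intro nn_integral_cong)
      fix y assume y: "y \<in> space ?C"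
      then have "(\<integral>\<^sup>+s. ennreal (q y x) * (\<Sum>k\<le>n. occupation k s y) * ?e s \<partial>lborel) =
        (\<integral>\<^sup>+s. (\<Sum>k\<le>n. ennreal (q y x) * (occupation k s y * ?e s)) \<partial>lborel)"
        by (intro nn_integral_cong) (simp only: sum_distrib_left sum_distrib_right mult.assoc)
      also have "\<dots> = (\<Sum>k\<le>n. \<integral>\<^sup>+s. ennreal (q y x) * (occupation k s y * ?e s) \<partial>lborel)"
        using y by (intro nn_integral_sum) auto
      also have "\<dots> = (\<Sum>k\<le>n. ennreal (q y x) * (\<integral>\<^sup>+s. occupation k s y * ?e s \<partial>lborel))"
        using y by (intro sum.cong refl nn_integral_cmult) auto
      finally show "(\<Sum>k\<le>n. ennreal (q y x) * (\<integral>\<^sup>+s. occupation k s y * ?e s \<partial>lborel)) =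
        (\<integral>\<^sup>+s. ennreal (q y x) * (\<Sum>k\<le>n. occupation k s y) * ?e s \<partial>lborel)" ..
    qed
    also have "\<dots> = (\<integral>\<^sup>+s. (\<integral>\<^sup>+y. ennreal (q y x) * (\<Sum>k\<le>n. occupation k s y) * ?e s \<partial>?C) \<partial>lborel)"
      by (rule nn_integral_count_space_nn_integral[symmetric, OF C]) auto
    \<comment> \<open>For \<open>s\<close> in \<open>{0..t}\<close> the induction hypothesis
      replaces the partial sum of occupations by \<open>f s y\<close>, and the inflow hypothesis
      then applies.\<close>
    also have "\<dots> \<le> (\<integral>\<^sup>+s. ennreal (D s x * exp (- r x * (t - s))) * indicator {0..t} s \<partial>lborel)"
    proof (intro nn_integral_mono)
      fix s :: real
      show "(\<integral>\<^sup>+y. ennreal (q y x) * (\<Sum>k\<le>n. occupation k s y) * ?e s \<partial>?C)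
        \<le> ennreal (D s x * exp (- r x * (t - s))) * indicator {0..t} s"
      proof (cases "s \<in> {0..t}")
        case True
        then have "(\<integral>\<^sup>+y. ennreal (q y x) * (\<Sum>k\<le>n. occupation k s y) \<partial>?C)
            \<le> (\<integral>\<^sup>+y. ennreal (q y x) * ennreal (f s y) \<partial>?C)"
          by (intro nn_integral_mono mult_left_mono Suc.IH) auto
        also have "\<dots> \<le> ennreal (D s x)"
          using True x by (intro inflow) auto
        finally have "(\<integral>\<^sup>+y. ennreal (q y x) * (\<Sum>k\<le>n. occupation k s y) \<partial>?C) * ?e s
          \<le> ennreal (D s x) * ?e s"
          by (rule mult_right_mono) simp
        then show ?thesis
          using True D_nonneg[of s x] x by (simp add: nn_integral_multc ennreal_mult)
      qed simp
    qed
    also have "\<dots> = ennreal (?F t - ?F 0)"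
    proof (rule nn_integral_FTC_Icc[OF _ _ _ t])
      show "(\<lambda>s. D s x * exp (- r x * (t - s))) \<in> borel_measurable borel" by measurable
    next
      fix s assume s: "s \<in> {0..t}"
      then show "(?F has_real_derivative D s x * exp (- r x * (t - s))) (at s)"
        using x by (auto intro!: derivative_eq_intros deriv simp: algebra_simps)
      show "0 \<le> D s x * exp (- r x * (t - s))"
        using s x D_nonneg by simp
    qed
    finally have "(\<Sum>k\<le>n. occupation (Suc k) t x) \<le> ennreal (f t x - \<mu> x * exp (- r x * t))"
      by (simp add: f_0 x)
    then have "occupation 0 t x + (\<Sum>k\<le>n. occupation (Suc k) t x)
       \<le> ennreal (\<mu> x * exp (- r x * t)) + ennreal (f t x - \<mu> x * exp (- r x * t))"
      by (simp add: occupation_0 x t add_left_mono)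
    also have "\<dots> = ennreal (f t x)"
    proof (rule ennreal_plus[symmetric, THEN trans])
      show "0 \<le> f t x - \<mu> x * exp (- r x * t)"
        using lower[OF t x] by simp
    qed (simp_all add: init_nonneg x)
    finally show ?case
      by (simp only: sum.atMost_Suc_shift)
  qed
qed

section \<open>Non-explosion\<close>

text \<open>A visit to \<open>x\<close> discounts by \<open>r x / (\<theta> + r x)\<close>, and the
  jump out of \<open>x\<close> changes \<open>u\<close> on average by a factor at most
  \<open>\<beta> * (\<theta> + r x) / r x\<close>. The product is at most \<open>\<beta>\<close>, so
  the discounted weight \<open>U\<close> contracts geometrically.\<close>

lemma AE_jump_time_exceeds:
  fixes u :: "'s \<Rightarrow> real" and \<theta> \<beta> :: real
  assumes u: "\<And>x. x \<in> S \<Longrightarrow> 1 \<le> u x"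
    and \<theta>: "0 \<le> \<theta>" and \<beta>: "0 \<le> \<beta>" "\<beta> < 1"
    and drift: "\<And>x. x \<in> S \<Longrightarrow> (\<integral>\<^sup>+y. ennreal (q x y) * ennreal (u y) \<partial>count_space (S - {x}))
      \<le> ennreal (\<beta> * (\<theta> + r x) * u x)"
  shows "AE \<omega> in M. \<exists>n. t < jump_time n \<omega>"
proof -
  let ?b = "\<lambda>x. ennreal (1 / u x)"
  let ?\<psi> = "\<lambda>s. ennreal (exp (- \<theta> * s))"
  define U where "U n = (\<integral>\<^sup>+x. state_integral ?b n x ?\<psi> * ennreal (u x) \<partial>count_space S)" for n
  have U_0: "U 0 = 1"
  proof -
    have "U 0 = (\<integral>\<^sup>+x. (\<integral>\<^sup>+\<omega>. (if Y 0 \<omega> = x then 1 else 0) \<partial>M) \<partial>count_space S)"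
      unfolding U_def
    proof (intro nn_integral_cong)
      fix x assume x: "x \<in> space (count_space S)"
      have "state_integral ?b 0 x ?\<psi> * ennreal (u x)
          = (\<integral>\<^sup>+\<omega>. ?\<psi> (jump_time 0 \<omega>) * (if Y 0 \<omega> = x then ?b (Y 0 \<omega>) else 0) * ennreal (u x) \<partial>M)"
        unfolding state_integral_def by (rule nn_integral_multc[symmetric]) measurable
      also have "\<dots> = (\<integral>\<^sup>+\<omega>. (if Y 0 \<omega> = x then 1 else 0) \<partial>M)"
        using u[of x] x by (intro nn_integral_cong) (auto simp: jump_time_def simp flip: ennreal_mult)
      finally show "state_integral ?b 0 x ?\<psi> * ennreal (u x) = (\<integral>\<^sup>+\<omega>. (if Y 0 \<omega> = x then 1 else 0) \<partial>M)" .
    qed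
    also have "\<dots> = (\<integral>\<^sup>+\<omega>. 1 \<partial>M)"
      by (rule nn_integral_split_state[symmetric]) simp
    finally show ?thesis using emeasure_space_1 by simp
  qed
  have U_Suc: "U (Suc n) \<le> ennreal \<beta> * U n" for n
  proof -
    let ?J = "\<lambda>x. state_integral ?b n x ?\<psi>"
    have J: "state_integral ?b n x (\<lambda>s. \<integral>\<^sup>+e. ?\<psi> (s + e) \<partial>exponential (r x))
        = ennreal (r x / (\<theta> + r x)) * ?J x" if x: "x \<in> S" for x
    proof -
      have "(\<integral>\<^sup>+e. ?\<psi> (s + e) \<partial>exponential (r x)) = ?\<psi> s * ennreal (r x / (\<theta> + r x))" for s
      proof -
        have "(\<integral>\<^sup>+e. ?\<psi> (s + e) \<partial>exponential (r x)) = (\<integral>\<^sup>+e. ?\<psi> s * ?\<psi> e \<partial>exponential (r x))"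
          by (intro nn_integral_cong) (simp add: algebra_simps exp_add exp_diff exp_minus divide_inverse flip: ennreal_mult)
        also have "\<dots> = ?\<psi> s * (\<integral>\<^sup>+e. ?\<psi> e \<partial>exponential (r x))"
          by (rule nn_integral_cmult) measurable
        finally show ?thesis
          using nn_integral_exponential_exp[OF exit_rate_pos[OF x] \<theta>] by simp
      qed
      then have "state_integral ?b n x (\<lambda>s. \<integral>\<^sup>+e. ?\<psi> (s + e) \<partial>exponential (r x)) =
        (\<integral>\<^sup>+\<omega>. ennreal (r x / (\<theta> + r x)) * (?\<psi> (jump_time n \<omega>) * (if Y n \<omega> = x then ?b (Y 0 \<omega>) else 0)) \<partial>M)"
        by (simp only: state_integral_def mult_ac)
      also have "\<dots> = ennreal (r x / (\<theta> + r x)) * ?J x"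
        unfolding state_integral_def by (rule nn_integral_cmult) measurable
      finally show ?thesis .
    qed
    have "U (Suc n) = (\<integral>\<^sup>+z. (\<integral>\<^sup>+x. ennreal (p x z) * (ennreal (r x / (\<theta> + r x)) * ?J x)
        \<partial>count_space S) * ennreal (u z) \<partial>count_space S)"
      unfolding U_def
      by (intro nn_integral_cong, subst state_integral_Suc)
        (auto intro!: arg_cong2[where f="(*)"] nn_integral_cong simp: J[simplified])
    also have "\<dots> = (\<integral>\<^sup>+z. (\<integral>\<^sup>+x. ennreal (p x z) * (ennreal (r x / (\<theta> + r x)) * ?J x) * ennreal (u z)
        \<partial>count_space S) \<partial>count_space S)"
      by (simp add: nn_integral_multc)
    also have "\<dots> = (\<integral>\<^sup>+x. (\<integral>\<^sup>+z. ennreal (p x z) * (ennreal (r x / (\<theta> + r x)) * ?J x) * ennreal (u z)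
        \<partial>count_space S) \<partial>count_space S)"
      by (rule nn_integral_count_space_nn_integral[OF countable_S]) simp
    also have "\<dots> \<le> (\<integral>\<^sup>+x. ennreal \<beta> * (?J x * ennreal (u x)) \<partial>count_space S)"
    proof (intro nn_integral_mono)
      fix x assume "x \<in> space (count_space S)"
      then have x: "x \<in> S" by simp
      note rx = exit_rate_pos[OF x]
      have "(\<integral>\<^sup>+z. ennreal (p x z) * (ennreal (r x / (\<theta> + r x)) * ?J x) * ennreal (u z) \<partial>count_space S)
        = (\<integral>\<^sup>+z. ennreal (p x z) * (ennreal (r x / (\<theta> + r x)) * ?J x) * ennreal (u z) \<partial>count_space (S - {x}))"
        using rx by (intro nn_integral_count_space_eq) (auto simp: jump_prob_def)
      also have "\<dots> = (\<integral>\<^sup>+z. (ennreal (1 / (\<theta> + r x)) * ?J x) * (ennreal (q x z) * ennreal (u z)) \<partial>count_space (S - {x}))"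
      proof (intro nn_integral_cong)
        fix z assume "z \<in> space (count_space (S - {x}))"
        then have z: "z \<in> S" "z \<noteq> x" by auto
        have "ennreal (p x z) * (ennreal (r x / (\<theta> + r x)) * ?J x) * ennreal (u z) =
            (ennreal (p x z) * ennreal (r x / (\<theta> + r x))) * (?J x * ennreal (u z))"
          by (simp only: mult.assoc)
        also have "ennreal (p x z) * ennreal (r x / (\<theta> + r x)) = ennreal (1 / (\<theta> + r x)) * ennreal (q x z)"
          using rx \<theta> z x q_nonneg[of x z] by (simp add: jump_prob_def flip: ennreal_mult)
        finally show "ennreal (p x z) * (ennreal (r x / (\<theta> + r x)) * ?J x) * ennreal (u z)
          = (ennreal (1 / (\<theta> + r x)) * ?J x) * (ennreal (q x z) * ennreal (u z))"
          by (simp only: mult_ac)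
      qed
      also have "\<dots> = (ennreal (1 / (\<theta> + r x)) * ?J x) *
          (\<integral>\<^sup>+z. ennreal (q x z) * ennreal (u z) \<partial>count_space (S - {x}))"
        by (rule nn_integral_cmult) simp
      also have "\<dots> \<le> (ennreal (1 / (\<theta> + r x)) * ?J x) * ennreal (\<beta> * (\<theta> + r x) * u x)"
        by (intro mult_left_mono drift x) simp
      also have "\<dots> = (ennreal (1 / (\<theta> + r x)) * ennreal (\<beta> * (\<theta> + r x) * u x)) * ?J x"
        by (simp add: mult_ac)
      also have "ennreal (1 / (\<theta> + r x)) * ennreal (\<beta> * (\<theta> + r x) * u x) = ennreal (\<beta> * u x)"
        using rx \<theta> \<beta> u[OF x] by (simp flip: ennreal_mult)
      also have "ennreal (\<beta> * u x) * ?J x = ennreal \<beta> * (?J x * ennreal (u x))"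
        using \<beta> u[OF x] by (simp add: ennreal_mult mult_ac)
      finally show "(\<integral>\<^sup>+z. ennreal (p x z) * (ennreal (r x / (\<theta> + r x)) * ?J x) * ennreal (u z) \<partial>count_space S)
        \<le> ennreal \<beta> * (?J x * ennreal (u x))" .
    qed
    also have "\<dots> = ennreal \<beta> * U n"
      unfolding U_def by (rule nn_integral_cmult) simp
    finally show ?thesis .
  qed
  have U_le: "U n \<le> ennreal (\<beta> ^ n)" for n
  proof (induction n)
    case (Suc n)
    have "U (Suc n) \<le> ennreal \<beta> * U n" by (rule U_Suc)
    also have "\<dots> \<le> ennreal \<beta> * ennreal (\<beta> ^ n)" by (intro mult_left_mono Suc.IH) simp
    finally show ?case using \<beta> by (simp add: ennreal_mult)
  qed (simp add: U_0)
  let ?A = "{\<omega> \<in> space M. \<forall>n. jump_time n \<omega> \<le> t}"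
  \<comment> \<open>On \<open>?A\<close> every jump time is at most \<open>t\<close>, so the
    discount stays above \<open>?\<psi> t\<close>, and \<open>u\<close> is at least 1. Thus
    \<open>U n\<close> bounds the integral for every \<open>n\<close>; its integrand is strictly
    positive on \<open>?A\<close>, which forces \<open>?A\<close> to be null.\<close>
  have A_le: "(\<integral>\<^sup>+\<omega>. ?\<psi> t * ?b (Y 0 \<omega>) * indicator ?A \<omega> \<partial>M) \<le> ennreal (\<beta> ^ n)" for n
  proof -
    have "(\<integral>\<^sup>+\<omega>. ?\<psi> t * ?b (Y 0 \<omega>) * indicator ?A \<omega> \<partial>M) \<le> (\<integral>\<^sup>+\<omega>. ?\<psi> (jump_time n \<omega>) * ?b (Y 0 \<omega>) \<partial>M)"
      using \<theta> by (intro nn_integral_mono)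
        (auto simp: indicator_def intro!: mult_right_mono ennreal_leI mult_left_mono)
    also have "\<dots> = (\<integral>\<^sup>+x. (\<integral>\<^sup>+\<omega>. (if Y n \<omega> = x then ?\<psi> (jump_time n \<omega>) * ?b (Y 0 \<omega>) else 0) \<partial>M) \<partial>count_space S)"
      by (rule nn_integral_split_state) measurable
    also have "\<dots> = (\<integral>\<^sup>+x. state_integral ?b n x ?\<psi> \<partial>count_space S)"
      unfolding state_integral_def by (intro nn_integral_cong) auto
    also have "\<dots> \<le> (\<integral>\<^sup>+x. state_integral ?b n x ?\<psi> * ennreal (u x) \<partial>count_space S)"
    proof (intro nn_integral_mono)
      fix x assume "x \<in> space (count_space S)"
      then have "1 \<le> ennreal (u x)" using u by (auto simp flip: ennreal_1 intro!: ennreal_leI)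
      from mult_left_mono[OF this, of "state_integral ?b n x ?\<psi>"]
      show "state_integral ?b n x ?\<psi> \<le> state_integral ?b n x ?\<psi> * ennreal (u x)" by simp
    qed
    also have "\<dots> \<le> ennreal (\<beta> ^ n)" using U_le[of n] by (simp add: U_def)
    finally show ?thesis .
  qed
  have "(\<lambda>n. ennreal (\<beta> ^ n)) \<longlonglongrightarrow> ennreal 0"
    using \<beta> by (intro tendsto_ennrealI LIMSEQ_realpow_zero) auto
  then have "(\<integral>\<^sup>+\<omega>. ?\<psi> t * ?b (Y 0 \<omega>) * indicator ?A \<omega> \<partial>M) \<le> ennreal 0"
    by (rule LIMSEQ_le_const) (use A_le in auto)
  then have "(\<integral>\<^sup>+\<omega>. ?\<psi> t * ?b (Y 0 \<omega>) * indicator ?A \<omega> \<partial>M) = 0" by simp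
  then have "AE \<omega> in M. ?\<psi> t * ?b (Y 0 \<omega>) * indicator ?A \<omega> = 0"
    by (subst (asm) nn_integral_0_iff_AE) measurable
  then show ?thesis
    using AE_space
  proof eventually_elim
    case (elim \<omega>)
    have "?\<psi> t * ?b (Y 0 \<omega>) \<noteq> 0"
      using u[OF Y_in_S[OF elim(2), of 0]] by simp
    with elim have "\<omega> \<notin> ?A" by (auto simp: indicator_def)
    with elim(2) show ?case by (auto simp: not_le)
  qed
qed

end

section \<open>Identification of the law by its total mass\<close>

text \<open>Non-explosion and \<open>sum_occupation_le\<close> place the law below \<open>f\<close>.
  As the law has mass one and \<open>f\<close> has mass at most one, the two coincide in every
  state.\<close>

theorem markov_chain_law:
  fixes f D :: "real \<Rightarrow> 's \<Rightarrow> real" and u :: "'s \<Rightarrow> real" and \<theta> \<beta> :: real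
  assumes X: "continuous_time_markov_chain M S q \<mu> X"
    and exit_pos: "\<And>x. x \<in> S \<Longrightarrow> 0 < exit_rate S q x"
    and init: "(\<integral>\<^sup>+x. ennreal (\<mu> x) \<partial>count_space S) = 1"
    and f_nonneg: "\<And>s x. 0 \<le> s \<Longrightarrow> x \<in> S \<Longrightarrow> 0 \<le> f s x"
    and f_0: "\<And>x. x \<in> S \<Longrightarrow> f 0 x = \<mu> x"
    and deriv: "\<And>s x. 0 \<le> s \<Longrightarrow> x \<in> S \<Longrightarrow>
      ((\<lambda>s. f s x) has_real_derivative D s x - exit_rate S q x * f s x) (at s)"
    and D_cont: "\<And>x. x \<in> S \<Longrightarrow> continuous_on UNIV (\<lambda>s. D s x)"
    and D_nonneg: "\<And>s x. 0 \<le> s \<Longrightarrow> x \<in> S \<Longrightarrow> 0 \<le> D s x"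
    and inflow: "\<And>s x. 0 \<le> s \<Longrightarrow> x \<in> S \<Longrightarrow>
      (\<integral>\<^sup>+y. ennreal (q y x) * ennreal (f s y) \<partial>count_space (S - {x})) \<le> ennreal (D s x)"
    and f_sum: "\<And>s. 0 \<le> s \<Longrightarrow> (\<integral>\<^sup>+x. ennreal (f s x) \<partial>count_space S) \<le> 1"
    and u: "\<And>x. x \<in> S \<Longrightarrow> 1 \<le> u x"
    and \<theta>: "0 \<le> \<theta>" and \<beta>: "0 \<le> \<beta>" "\<beta> < 1"
    and drift: "\<And>x. x \<in> S \<Longrightarrow> (\<integral>\<^sup>+y. ennreal (q x y) * ennreal (u y) \<partial>count_space (S - {x}))
      \<le> ennreal (\<beta> * (\<theta> + exit_rate S q x) * u x)"
    and t: "0 \<le> t" and x: "x \<in> S"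
  shows "measure M {\<omega> \<in> space M. X t \<omega> = x} = f t x"
proof -
  interpret continuous_time_markov_chain M S q \<mu> X by fact
  obtain Y H where YH: "jump_chain_holding_times M S q \<mu> Y H"
    and XY: "AE \<omega> in M. \<forall>t\<ge>0. \<forall>n.
         (\<Sum>k<n. H k \<omega>) \<le> ennreal t \<and> ennreal t < (\<Sum>k<Suc n. H k \<omega>) \<longrightarrow> X t \<omega> = Y n \<omega>"
    using jump_description by blast
  interpret J: jump_chain_holding_times M S q \<mu> Y H by fact
  interpret J: positive_rate_jump_chain M S q \<mu> Y H
    by unfold_locales (use countable_states rate_nonneg rate_summable exit_pos init in auto)
  have X_sets [measurable]: "{\<omega> \<in> space M. X t \<omega> = z} \<in> sets M" if "z \<in> S" for z
  proof -
    have "{\<omega> \<in> space M. X t \<omega> = z} = X t -` {z} \<inter> space M" by auto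
    then show ?thesis using measurable_sets[OF measurable_state[OF t], of "{z}"] that by simp
  qed
  have exceeds: "AE \<omega> in M. \<exists>n. t < J.jump_time n \<omega>"
    by (rule J.AE_jump_time_exceeds[of u \<theta> \<beta>]) (use u \<theta> \<beta> drift in auto)
  \<comment> \<open>The least \<open>n\<close> whose jump time exceeds \<open>t\<close> is positive,
    since jump time 0 is 0; its predecessor numbers the holding interval containing
    \<open>t\<close>.\<close>
  have found: "AE \<omega> in M. \<exists>n. J.jump_time n \<omega> \<le> t \<and> t < J.jump_time (Suc n) \<omega> \<and> X t \<omega> = Y n \<omega>"
    using XY J.AE_holding_time_finite exceeds
  proof eventually_elim
    case (elim \<omega>)
    have H: "H k \<omega> = ennreal (J.h k \<omega>)" for k
      using elim(2) by (simp add: J.h_def less_top)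
    have T: "(\<Sum>k<n. H k \<omega>) = ennreal (J.jump_time n \<omega>)" for n
      by (simp add: H J.jump_time_def sum_ennreal J.h_nonneg)
    define n where "n = (LEAST n. t < J.jump_time n \<omega>)"
    have n: "t < J.jump_time n \<omega>"
      unfolding n_def using elim(3) by (rule LeastI_ex)
    then have "n \<noteq> 0" using t by (auto simp: J.jump_time_def intro!: Nat.gr0I)
    then obtain m where m: "n = Suc m" by (cases n) auto
    have "J.jump_time m \<omega> \<le> t"
      using not_less_Least[of m "\<lambda>n. t < J.jump_time n \<omega>"] m by (auto simp: n_def)
    moreover have "X t \<omega> = Y m \<omega>"
      using elim(1) t n \<open>J.jump_time m \<omega> \<le> t\<close> m
      unfolding T by (auto simp: ennreal_less_iff ennreal_leI)
    ultimately show ?case using n m by auto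
  qed
  have le: "emeasure M {\<omega> \<in> space M. X t \<omega> = z} \<le> ennreal (f t z)" if z: "z \<in> S" for z
  proof -
    let ?B = "\<lambda>n. {\<omega> \<in> space M. Y n \<omega> = z \<and> J.jump_time n \<omega> \<le> t \<and> t < J.jump_time (Suc n) \<omega>}"
    have "emeasure M {\<omega> \<in> space M. X t \<omega> = z} \<le> emeasure M (\<Union>n. ?B n)"
    proof (rule emeasure_mono_AE)
      show "AE \<omega> in M. \<omega> \<in> {\<omega> \<in> space M. X t \<omega> = z} \<longrightarrow> \<omega> \<in> (\<Union>n. ?B n)"
        using found by eventually_elim auto
      show "(\<Union>n. ?B n) \<in> sets M" by measurable
    qed
    also have "\<dots> \<le> (\<Sum>n. J.occupation n t z)"
      unfolding J.occupation_def by (rule emeasure_subadditive_countably) auto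
    also have "\<dots> \<le> ennreal (f t z)"
    proof (rule LIMSEQ_le_const2)
      show "(\<lambda>n. \<Sum>k\<le>n. J.occupation k t z) \<longlonglongrightarrow> (\<Sum>n. J.occupation n t z)"
        by (rule summable_LIMSEQ') simp
      show "\<exists>N. \<forall>n\<ge>N. (\<Sum>k\<le>n. J.occupation k t z) \<le> ennreal (f t z)"
        using J.sum_occupation_le[of f D, OF f_nonneg f_0 deriv D_cont D_nonneg inflow t z] by auto
    qed
    finally show ?thesis .
  qed
  let ?P = "\<lambda>z. emeasure M {\<omega> \<in> space M. X t \<omega> = z}"
  have "(\<Union>z\<in>S. {\<omega> \<in> space M. X t \<omega> = z}) = space M"
    using measurable_space[OF measurable_state[OF t]] by auto
  then have "1 = emeasure M (\<Union>z\<in>S. {\<omega> \<in> space M. X t \<omega> = z})"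
    by (simp add: emeasure_space_1)
  also have "\<dots> = (\<integral>\<^sup>+z. ?P z \<partial>count_space S)"
    by (rule emeasure_UN_countable) (auto simp: disjoint_family_on_def countable_states)
  finally have P_sum: "(\<integral>\<^sup>+z. ?P z \<partial>count_space S) = 1" ..
  \<comment> \<open>The differences are nonnegative with integral 0. For counting measure, almost
    everywhere means everywhere on \<open>S\<close>.\<close>
  have "(\<integral>\<^sup>+z. ennreal (f t z) - ?P z \<partial>count_space S) =
    (\<integral>\<^sup>+z. ennreal (f t z) \<partial>count_space S) - (\<integral>\<^sup>+z. ?P z \<partial>count_space S)"
    by (rule nn_integral_diff) (auto simp: P_sum le intro!: AE_I2)
  also have "\<dots> = 0"
    using f_sum[OF t] le_less_trans[OF f_sum[OF t] ennreal_one_less_top]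
    by (simp add: P_sum diff_eq_0_iff_ennreal)
  finally have "AE z in count_space S. ennreal (f t z) - ?P z = 0"
    by (subst (asm) nn_integral_0_iff_AE) auto
  then have "ennreal (f t x) - ?P x = 0"
    using x by (simp add: AE_count_space)
  then have "ennreal (f t x) \<le> ?P x"
    by (simp add: diff_eq_0_iff_ennreal)
  with le[OF x] have "?P x = ennreal (f t x)" by (rule antisym)
  then show ?thesis
    using f_nonneg[OF t x] by (simp add: measure_def)
qed

section \<open>Totally asymmetric walks\<close>

lemma (in continuous_time_markov_chain) exit_rate_eqI:
  assumes x: "x \<in> S" and c: "0 \<le> c"
    and sum: "(\<integral>\<^sup>+y. ennreal (q x y) \<partial>count_space (S - {x})) = ennreal c"
  shows "exit_rate S q x = c"
proof -
  have "ennreal (exit_rate S q x) = (\<integral>\<^sup>+y. ennreal (q x y) \<partial>count_space (S - {x}))"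
    unfolding exit_rate_def using x
    by (intro nn_integral_count_space_eq_infsum[symmetric] rate_summable) (auto intro!: rate_nonneg)
  moreover have "0 \<le> exit_rate S q x"
    unfolding exit_rate_def using x by (intro infsum_nonneg) (auto intro!: rate_nonneg)
  ultimately show ?thesis using sum c by simp
qed

section \<open>Poisson weights\<close>

text \<open>Unlike \<open>walk_weight\<close>, which truncates a negative displacement to 0 by
  \<open>nat\<close>, this version vanishes for negative \<open>k\<close>. The forward equation then
  holds on all of the integers without a boundary case.\<close>

definition poisson_weight :: "real \<Rightarrow> real \<Rightarrow> int \<Rightarrow> real" where
  "poisson_weight w t k =
    (if 0 \<le> k then exp (- (w * t)) * (w * t) ^ nat k / fact (nat k) else 0)"

lemma walk_weight_eq_poisson_weight: "x \<le> y \<Longrightarrow> walk_weight w t y x = poisson_weight w t (y - x)"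
  by (simp add: walk_weight_def poisson_weight_def)

lemma poisson_weight_nonneg: "0 \<le> w \<Longrightarrow> 0 \<le> t \<Longrightarrow> 0 \<le> poisson_weight w t k"
  by (simp add: poisson_weight_def)

lemma poisson_weight_0: "poisson_weight w 0 k = (if k = 0 then 1 else 0)"
  by (auto simp: poisson_weight_def power_0_left)

text \<open>The forward equation of the Poisson process. At \<open>k = 0\<close> the gain term is 0
  by the extension to negative arguments.\<close>

lemma has_derivative_poisson_weight:
  "((\<lambda>t. poisson_weight w t k) has_real_derivative
    w * poisson_weight w t (k - 1) - w * poisson_weight w t k) (at t)"
proof (cases "k \<le> 0")
  case True
  then show ?thesis
    by (cases "k = 0") (auto simp: poisson_weight_def intro!: derivative_eq_intros)
next
  case False
  then obtain n where k: "k = int (Suc n)"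
    by (metis not_le zero_less_imp_eq_int not0_implies_Suc less_irrefl_nat)
  have k: "nat k = Suc n" "nat (k - 1) = n" "0 \<le> k" "0 \<le> k - 1" by (simp_all add: k)
  have e: "((\<lambda>t. exp (- (w * t))) has_real_derivative - w * exp (- (w * t))) (at t)"
    by (auto intro!: derivative_eq_intros)
  have pow: "((\<lambda>t. (w * t) ^ Suc n / fact (Suc n)) has_real_derivative
      w * ((w * t) ^ n / fact n)) (at t)"
    by (rule derivative_eq_intros refl | simp del: power_Suc fact_Suc)+
      (simp add: divide_simps)
  have "((\<lambda>t. exp (- (w * t)) * ((w * t) ^ Suc n / fact (Suc n))) has_real_derivative
    w * (exp (- (w * t)) * (w * t) ^ n / fact n)
      - w * (exp (- (w * t)) * (w * t) ^ Suc n / fact (Suc n))) (at t)"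
    by (rule DERIV_cong[OF DERIV_mult[OF e pow]]) (simp add: mult_ac del: power_Suc fact_Suc)
  with k show ?thesis by (simp add: poisson_weight_def del: power_Suc fact_Suc)
qed

lemma continuous_on_poisson_weight [continuous_intros]:
  "continuous_on A (\<lambda>t. poisson_weight w t k)"
  by (rule DERIV_continuous_on[OF has_field_derivative_at_within[OF has_derivative_poisson_weight]])

lemma has_sum_poisson_weight:
  assumes "0 \<le> w" "0 \<le> t"
  shows "((\<lambda>y. poisson_weight w t (y - x)) has_sum 1) {x..}"
proof -
  have "(\<lambda>n. (w * t) ^ n /\<^sub>R fact n) sums exp (w * t)" by (rule exp_converges)
  then have "(\<lambda>n. exp (- (w * t)) * ((w * t) ^ n /\<^sub>R fact n)) sums (exp (- (w * t)) * exp (w * t))"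
    by (rule sums_mult)
  then have "(\<lambda>n. poisson_weight w t (int n)) sums 1"
    by (simp add: poisson_weight_def divide_inverse mult_ac flip: exp_add)
  then have "((\<lambda>n. poisson_weight w t (int n)) has_sum 1) UNIV"
    by (intro norm_summable_imp_has_sum)
      (auto simp: poisson_weight_nonneg assms sums_iff abs_of_nonneg)
  also have "?this \<longleftrightarrow> ((\<lambda>y. poisson_weight w t (y - x)) has_sum 1) {x..}"
    by (intro has_sum_reindex_bij_witness[of _ "\<lambda>y. nat (y - x)" "\<lambda>n. x + int n"]) auto
  finally show ?thesis .
qed

text \<open>The sign \<open>\<sigma>\<close> treats the two walk directions at once; the map
  \<open>\<sigma> * (y - x)\<close> is a bijection of the integers.\<close>

lemma nn_integral_poisson_weight:
  assumes wt: "0 \<le> w" "0 \<le> t" and \<sigma>: "\<sigma> = 1 \<or> \<sigma> = - 1"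
  shows "(\<integral>\<^sup>+y. ennreal (poisson_weight w t (\<sigma> * (y - x))) \<partial>count_space UNIV) = 1"
proof -
  have "bij (\<lambda>y. \<sigma> * (y - x))"
    using \<sigma> by (intro bij_betw_byWitness[where f'="\<lambda>k. \<sigma> * k + x"]) (auto simp: algebra_simps)
  then have "(\<integral>\<^sup>+y. ennreal (poisson_weight w t (\<sigma> * (y - x))) \<partial>count_space UNIV)
      = (\<integral>\<^sup>+k. ennreal (poisson_weight w t k) \<partial>count_space UNIV)"
    by (rule nn_integral_bij_count_space[where f="\<lambda>k. ennreal (poisson_weight w t k)"])
  also have "\<dots> = (\<integral>\<^sup>+k. ennreal (poisson_weight w t k) \<partial>count_space {0..})"
    by (intro nn_integral_count_space_eq) (auto simp: poisson_weight_def)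
  also have "\<dots> = ennreal 1"
    using has_sum_poisson_weight[OF wt, of 0]
    by (subst nn_integral_count_space_eq_infsum)
      (auto simp: has_sum_imp_summable poisson_weight_nonneg wt infsumI)
  finally show ?thesis by simp
qed

section \<open>Laws of the left and right walks\<close>

lemma nn_integral_count_space_single:
  fixes F :: "'a \<Rightarrow> ennreal"
  shows "(\<integral>\<^sup>+y. (if y = a then F y else 0) \<partial>count_space A) = (if a \<in> A then F a else 0)"
proof -
  have "(\<integral>\<^sup>+y. (if y = a then F y else 0) \<partial>count_space A) = (\<integral>\<^sup>+y. F a * indicator {a} y \<partial>count_space A)"
    by (intro nn_integral_cong) (auto simp: indicator_def)
  also have "\<dots> = (if a \<in> A then F a else 0)"
    by (cases "a \<in> A")
      (auto simp: nn_integral_cmult_indicator nn_integral_0_iff_AE AE_count_space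
        split: split_indicator simp del: nn_integral_indicator_singleton)
  finally show ?thesis .
qed

lemma asymmetric_walk_law:
  fixes X :: "real \<Rightarrow> 'm \<Rightarrow> int"
  assumes w: "0 < w" and t: "0 \<le> t" and \<sigma>: "\<sigma> = 1 \<or> \<sigma> = - 1"
    and X: "continuous_time_markov_chain M UNIV (\<lambda>x y. if y = x + \<sigma> then w else 0)
       (\<lambda>x. if x = a then 1 else 0) X"
  shows "measure M {\<omega> \<in> space M. X t \<omega> = x} = poisson_weight w t (\<sigma> * (x - a))"
proof -
  let ?q = "\<lambda>x y. if y = x + \<sigma> then w else 0"
  interpret continuous_time_markov_chain M UNIV ?q "\<lambda>x. if x = a then 1 else 0" X by fact
  have out: "(\<integral>\<^sup>+y. ennreal (?q x y) * F y \<partial>count_space (UNIV - {x})) = ennreal w * F (x + \<sigma>)" for x F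
  proof -
    have "(\<integral>\<^sup>+y. ennreal (?q x y) * F y \<partial>count_space (UNIV - {x}))
        = (\<integral>\<^sup>+y. (if y = x + \<sigma> then ennreal w * F y else 0) \<partial>count_space (UNIV - {x}))"
      by (intro nn_integral_cong) auto
    then show ?thesis using \<sigma> by (subst (asm) nn_integral_count_space_single) auto
  qed
  have exit: "exit_rate UNIV ?q x = w" for x
    using out[of x "\<lambda>_. 1"] w by (intro exit_rate_eqI) auto
  have inflow: "(\<integral>\<^sup>+y. ennreal (?q y x) * F y \<partial>count_space (UNIV - {x})) = ennreal w * F (x - \<sigma>)" for x F
  proof -
    have "(\<integral>\<^sup>+y. ennreal (?q y x) * F y \<partial>count_space (UNIV - {x}))
        = (\<integral>\<^sup>+y. (if y = x - \<sigma> then ennreal w * F y else 0) \<partial>count_space (UNIV - {x}))"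
      by (intro nn_integral_cong) auto
    then show ?thesis using \<sigma> by (subst (asm) nn_integral_count_space_single) auto
  qed
  have init: "(\<integral>\<^sup>+x. ennreal (if x = a then 1 else 0) \<partial>count_space (UNIV :: int set)) = 1"
    using nn_integral_count_space_single[where a=a and F="\<lambda>_. 1" and A=UNIV]
    by (simp add: if_distrib[of ennreal] cong: if_cong)
  show ?thesis
  \<comment> \<open>All exit rates equal \<open>w\<close>, so the constant function
    \<open>u = 1\<close> works: with \<open>\<theta> = w\<close> and \<open>\<beta> = 1/2\<close>
    the drift condition is an equality.\<close>
  proof (rule markov_chain_law[where f="\<lambda>s x. poisson_weight w s (\<sigma> * (x - a))"
        and D="\<lambda>s x. w * poisson_weight w s (\<sigma> * (x - a) - 1)"
        and u="\<lambda>_. 1" and \<theta>=w and \<beta>="1/2", OF X])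
    show "((\<lambda>s. poisson_weight w s (\<sigma> * (x - a))) has_real_derivative
      w * poisson_weight w s (\<sigma> * (x - a) - 1) - exit_rate UNIV ?q x * poisson_weight w s (\<sigma> * (x - a))) (at s)"
      for s x
      unfolding exit by (rule has_derivative_poisson_weight)
    show "(\<integral>\<^sup>+y. ennreal (?q y x) * ennreal (poisson_weight w s (\<sigma> * (y - a))) \<partial>count_space (UNIV - {x}))
      \<le> ennreal (w * poisson_weight w s (\<sigma> * (x - a) - 1))" if "0 \<le> s" for s x
    proof -
      have "\<sigma> * (x - \<sigma> - a) = \<sigma> * (x - a) - 1"
        using \<sigma> by auto
      then show ?thesis
        using w that by (simp add: inflow poisson_weight_nonneg ennreal_mult)
    qed
    show "(\<integral>\<^sup>+y. ennreal (?q x y) * ennreal 1 \<partial>count_space (UNIV - {x}))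
      \<le> ennreal (1 / 2 * (w + exit_rate UNIV ?q x) * 1)" for x
      unfolding out exit by simp
  qed (use w t \<sigma> in \<open>auto simp: exit init poisson_weight_nonneg poisson_weight_0
      nn_integral_poisson_weight intro!: continuous_intros\<close>)
qed

section \<open>The headway exclusion process\<close>

definition advance :: "int list \<Rightarrow> nat \<Rightarrow> int list" where
  "advance xs i = xs[i := xs ! i + 1]"

definition gap :: "int list \<Rightarrow> nat \<Rightarrow> nat" where
  "gap xs i = nat (xs ! Suc i - xs ! i - 1)"

lemma configurations_iff:
  "xs \<in> configurations N \<longleftrightarrow> length xs = N \<and> (\<forall>i j. i < j \<longrightarrow> j < N \<longrightarrow> xs ! i < xs ! j)"
  by (auto simp: configurations_def sorted_wrt_iff_nth_less)

lemma int_gap: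
  assumes "xs \<in> configurations N" "Suc i < N"
  shows "int (gap xs i) = xs ! Suc i - xs ! i - 1"
proof -
  have "xs ! i < xs ! Suc i" using assms by (simp add: configurations_iff)
  then show ?thesis by (simp add: gap_def)
qed

lemma advance_in_configurations:
  assumes xs: "xs \<in> configurations N" and i: "i < N" and gap: "Suc i < N \<Longrightarrow> 0 < gap xs i"
  shows "advance xs i \<in> configurations N"
proof -
  have length: "length xs = N" using xs by (simp add: configurations_iff)
  have less: "xs ! j < xs ! k" if "j < k" "k < N" for j k
    using xs that by (auto simp: configurations_iff)
  have "xs ! i + 1 < xs ! k" if "i < k" "k < N" for k
  proof -
    have "Suc i < N" using that by simp
    then have "xs ! i + 1 < xs ! Suc i"
      using gap int_gap[OF xs, of i] by linarith
    also have "xs ! Suc i \<le> xs ! k"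
      using less[of "Suc i" k] that by (cases "k = Suc i") auto
    finally show ?thesis .
  qed
  moreover have "xs ! j < xs ! i + 1" if "j < i" for j
    using less[OF that i] by simp
  ultimately show ?thesis
    using less i length by (simp add: configurations_iff advance_def nth_list_update)
qed

section \<open>Gap weights and normalisation of the domain measures\<close>

locale headway_potential =
  fixes g :: "nat \<Rightarrow> real"
  assumes g_0: "g 0 = 0" and g_pos: "\<And>k. 1 \<le> k \<Longrightarrow> 0 < g k"
    and Z_summable: "summable (\<lambda>n. \<Prod>k=1..n. inverse (g k))"
begin

lemma g_nonneg: "0 \<le> g k"
  using g_0 g_pos[of k] by (cases k) auto

definition gap_weight :: "nat \<Rightarrow> real" where
  "gap_weight n = (\<Prod>k=1..n. inverse (g k))"

abbreviation "Z \<equiv> partition_function g"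

lemma gap_weight_pos: "0 < gap_weight n"
  unfolding gap_weight_def by (intro prod_pos) (simp add: g_pos)

lemma gap_weight_Suc: "gap_weight (Suc n) = gap_weight n * inverse (g (Suc n))"
  by (simp add: gap_weight_def mult.commute)

lemma Z_pos: "0 < Z"
  using suminf_pos[OF Z_summable] gap_weight_pos by (simp add: partition_function_def gap_weight_def)

lemma sum_gap_weight: "(\<integral>\<^sup>+k. ennreal (gap_weight k / Z) \<partial>count_space UNIV) = 1"
proof -
  have "(\<lambda>k. gap_weight k / Z) sums (Z / Z)"
    using summable_sums[OF Z_summable]
    by (intro sums_divide) (simp add: gap_weight_def partition_function_def)
  then have "(\<Sum>k. ennreal (gap_weight k / Z)) = ennreal (Z / Z)"
    using Z_pos gap_weight_pos by (intro suminf_ennreal_eq) (auto intro: less_imp_le)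
  then show ?thesis using Z_pos by (simp add: nn_integral_count_space_nat)
qed

lemma domain_measure_nonneg: "0 \<le> domain_measure g N y xs"
  unfolding domain_measure_def gap_weight_def[symmetric] using Z_pos gap_weight_pos
  by (intro mult_nonneg_nonneg divide_nonneg_nonneg prod_nonneg zero_le_power)
    (auto intro: less_imp_le)

lemma domain_measure_eq_0: "xs ! 0 \<noteq> y \<Longrightarrow> domain_measure g N y xs = 0"
  by (simp add: domain_measure_def)

text \<open>Removing the leftmost particle leaves a domain measure started from the second particle,
  times the probability weight of the first gap.\<close>

lemma domain_measure_Cons:
  "domain_measure g (Suc (Suc n)) y (y # ys) =
    gap_weight (nat (ys ! 0 - y - 1)) / Z * domain_measure g (Suc n) (ys ! 0) ys"
  unfolding domain_measure_def gap_weight_def[symmetric]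
  by (simp add: prod.lessThan_Suc_shift del: prod.lessThan_Suc)

lemma Cons_in_configurations:
  "y # ys \<in> configurations (Suc (Suc n)) \<longleftrightarrow> ys \<in> configurations (Suc n) \<and> y < ys ! 0"
  by (cases ys) (auto simp: configurations_def intro: less_trans)

text \<open>Induction on the number of particles: the first gap has law
  \<open>gap_weight k / Z\<close>, and given this gap the remaining particles follow the domain
  measure started at \<open>y + 1 + k\<close>.\<close>

lemma sum_domain_measure:
  "(\<integral>\<^sup>+xs. ennreal (domain_measure g (Suc n) y xs) \<partial>count_space (configurations (Suc n))) = 1"
proof (induction n arbitrary: y)
  case 0
  have "(\<integral>\<^sup>+xs. ennreal (domain_measure g (Suc 0) y xs) \<partial>count_space (configurations (Suc 0)))
    = (\<integral>\<^sup>+xs. (if xs = [y] then 1 else 0) \<partial>count_space (configurations (Suc 0)))"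
    by (intro nn_integral_cong) (auto simp: configurations_def domain_measure_def length_Suc_conv)
  then show ?case
    by (simp add: nn_integral_count_space_single) (simp add: configurations_def)
next
  case (Suc n)
  let ?C = "configurations (Suc n)"
  let ?B = "{ys \<in> ?C. y < ys ! 0}"
  let ?\<mu> = "domain_measure g (Suc n)"
  let ?A = "{xs \<in> configurations (Suc (Suc n)). xs ! 0 = y}"
  have Cons_tl: "y # tl xs = xs" if "xs \<in> ?A" for xs
    using that by (cases xs) (auto simp: configurations_def)
  have bij: "bij_betw (Cons y) ?B ?A"
  proof (rule bij_betw_byWitness[where f'=tl])
    show "tl ` ?A \<subseteq> ?B"
    proof safe
      fix xs assume "xs \<in> configurations (Suc (Suc n))" "y = xs ! 0"
      then have "y # tl xs \<in> configurations (Suc (Suc n))" using Cons_tl[of xs] by simp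
      then show "tl xs \<in> ?C" "xs ! 0 < tl xs ! 0"
        using \<open>y = xs ! 0\<close> unfolding Cons_in_configurations by simp_all
    qed
  qed (auto simp: Cons_in_configurations Cons_tl)
  have "(\<integral>\<^sup>+xs. ennreal (domain_measure g (Suc (Suc n)) y xs) \<partial>count_space (configurations (Suc (Suc n))))
    = (\<integral>\<^sup>+xs. ennreal (domain_measure g (Suc (Suc n)) y xs)
        \<partial>count_space ?A)"
    by (intro nn_integral_count_space_eq) (auto simp: domain_measure_eq_0)
  also have "\<dots> = (\<integral>\<^sup>+ys. ennreal (domain_measure g (Suc (Suc n)) y (y # ys)) \<partial>count_space ?B)"
    by (rule nn_integral_bij_count_space[OF bij, symmetric])
  \<comment> \<open>A sum over all gaps \<open>k\<close> is inserted in which only the actual first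
    gap contributes. After exchanging the sums, the induction hypothesis applies for each fixed
    \<open>k\<close>.\<close>
  also have "\<dots> = (\<integral>\<^sup>+ys. (\<integral>\<^sup>+k. ennreal (gap_weight k / Z) * ennreal (?\<mu> (y + 1 + int k) ys) \<partial>count_space UNIV) \<partial>count_space ?B)"
  proof (intro nn_integral_cong)
    fix ys assume "ys \<in> space (count_space ?B)"
    then have ys: "y < ys ! 0" by simp
    have "(\<integral>\<^sup>+k. ennreal (gap_weight k / Z) * ennreal (?\<mu> (y + 1 + int k) ys) \<partial>count_space UNIV) =
      (\<integral>\<^sup>+k. (if k = nat (ys ! 0 - y - 1) then ennreal (gap_weight k / Z) * ennreal (?\<mu> (ys ! 0) ys) else 0) \<partial>count_space UNIV)"
      using ys by (intro nn_integral_cong) (auto simp: domain_measure_eq_0)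
    also have "\<dots> = ennreal (domain_measure g (Suc (Suc n)) y (y # ys))"
      using Z_pos gap_weight_pos
      by (simp add: nn_integral_count_space_single domain_measure_Cons domain_measure_nonneg less_imp_le flip: ennreal_mult)
    finally show "ennreal (domain_measure g (Suc (Suc n)) y (y # ys)) =
      (\<integral>\<^sup>+k. ennreal (gap_weight k / Z) * ennreal (?\<mu> (y + 1 + int k) ys) \<partial>count_space UNIV)" ..
  qed
  also have "\<dots> = (\<integral>\<^sup>+k. (\<integral>\<^sup>+ys. ennreal (gap_weight k / Z) * ennreal (?\<mu> (y + 1 + int k) ys) \<partial>count_space ?B) \<partial>count_space UNIV)"
    by (rule nn_integral_count_space_nn_integral) auto
  also have "\<dots> = (\<integral>\<^sup>+k. ennreal (gap_weight k / Z) * (\<integral>\<^sup>+ys. ennreal (?\<mu> (y + 1 + int k) ys) \<partial>count_space ?B) \<partial>count_space UNIV)"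
    by (simp add: nn_integral_cmult)
  also have "\<dots> = (\<integral>\<^sup>+k. ennreal (gap_weight k / Z) * (\<integral>\<^sup>+ys. ennreal (?\<mu> (y + 1 + int k) ys) \<partial>count_space ?C) \<partial>count_space UNIV)"
    by (intro nn_integral_cong arg_cong2[where f="(*)"] nn_integral_count_space_eq refl)
      (auto simp: domain_measure_eq_0)
  also have "\<dots> = 1"
    using Suc.IH by (simp add: sum_gap_weight)
  finally show ?case .
qed

end

section \<open>Flows out of and into a configuration\<close>

locale tahep_parameters = headway_potential g for g :: "nat \<Rightarrow> real" +
  fixes w :: real and N :: nat
  assumes w_pos: "0 < w" and N_pos: "1 \<le> N"
begin

abbreviation "rate \<equiv> tahep_rate (headway_rates w g)"
abbreviation "S \<equiv> configurations N"
abbreviation "W xs i \<equiv> headway_rates w g (headway xs i)"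

lemma sum_split_last: "(\<Sum>i<N. F i) = (\<Sum>i<N - 1. F i) + F (N - 1)" for F :: "nat \<Rightarrow> real"
  using N_pos by (cases N) auto

lemma sum_split_first: "(\<Sum>i<N. F i) = F 0 + (\<Sum>i<N - 1. F (Suc i))" for F :: "nat \<Rightarrow> real"
  using N_pos by (cases N) (auto simp: sum.lessThan_Suc_shift simp del: sum.lessThan_Suc)

lemma W_eq: "xs \<in> S \<Longrightarrow> i < N \<Longrightarrow> W xs i = (if Suc i < N then w * g (gap xs i) else w)"
  by (simp add: headway_rates_def headway_def gap_def configurations_iff)

lemma W_nonneg: "xs \<in> S \<Longrightarrow> i < N \<Longrightarrow> 0 \<le> W xs i"
  using w_pos g_nonneg by (simp add: W_eq)

lemma length_S: "xs \<in> S \<Longrightarrow> length xs = N"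
  by (simp add: configurations_iff)

text \<open>Each particle contributes its own move. A move that would leave the configurations is
  onto an occupied site, where \<open>g 0 = 0\<close> makes its rate vanish, so no case distinction
  remains on the right.\<close>

lemma nn_integral_outflow:
  assumes xs: "xs \<in> S"
  shows "(\<integral>\<^sup>+ys. ennreal (rate xs ys) * F ys \<partial>count_space (S - {xs}))
    = (\<Sum>i<N. ennreal (W xs i) * F (advance xs i))"
proof -
  have "(\<integral>\<^sup>+ys. ennreal (rate xs ys) * F ys \<partial>count_space (S - {xs})) =
    (\<integral>\<^sup>+ys. (\<Sum>i<N. if ys = advance xs i then ennreal (W xs i) * F ys else 0) \<partial>count_space (S - {xs}))"
  proof (intro nn_integral_cong)
    fix ys
    have "ennreal (rate xs ys) = (\<Sum>i<N. ennreal (if ys = advance xs i then W xs i else 0))"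
      unfolding tahep_rate_def length_S[OF xs] advance_def
      by (rule sum_ennreal[symmetric]) (auto simp: W_nonneg xs)
    then show "ennreal (rate xs ys) * F ys
        = (\<Sum>i<N. if ys = advance xs i then ennreal (W xs i) * F ys else 0)"
      by (auto simp: sum_distrib_right intro!: sum.cong)
  qed
  also have "\<dots> = (\<Sum>i<N. \<integral>\<^sup>+ys. (if ys = advance xs i then ennreal (W xs i) * F ys else 0) \<partial>count_space (S - {xs}))"
    by (rule nn_integral_sum) simp
  also have "\<dots> = (\<Sum>i<N. ennreal (W xs i) * F (advance xs i))"
  proof (rule sum.cong[OF refl])
    fix i assume "i \<in> {..<N}"
    then have i: "i < N" by simp
    have "advance xs i ! i \<noteq> xs ! i"
      using i length_S[OF xs] by (simp add: advance_def)
    then have "advance xs i \<noteq> xs" by auto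
    moreover have "W xs i = 0" if "advance xs i \<notin> S"
    proof -
      have "\<not> (Suc i < N \<longrightarrow> 0 < gap xs i)"
        using advance_in_configurations[OF xs i] that by blast
      then show ?thesis using W_eq[OF xs i] g_0 by simp
    qed
    ultimately show "(\<integral>\<^sup>+ys. (if ys = advance xs i then ennreal (W xs i) * F ys else 0) \<partial>count_space (S - {xs}))
       = ennreal (W xs i) * F (advance xs i)"
      by (auto simp: nn_integral_count_space_single)
  qed
  finally show ?thesis .
qed

definition retreat :: "int list \<Rightarrow> nat \<Rightarrow> int list" where
  "retreat xs i = xs[i := xs ! i - 1]"

lemma eq_advance_iff:
  assumes "i < length ys"
  shows "xs = advance ys i \<longleftrightarrow> ys = retreat xs i \<and> i < length xs"
  using assms by (auto simp: advance_def retreat_def)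

text \<open>The only possible predecessors of \<open>xs\<close> are its retreats. The upper bound is
  the direction in which the inflow enters the comparison with \<open>f\<close>.\<close>

lemma nn_integral_inflow:
  assumes xs: "xs \<in> S"
  shows "(\<integral>\<^sup>+ys. ennreal (rate ys xs) * F ys \<partial>count_space (S - {xs}))
    \<le> (\<Sum>i<N. if retreat xs i \<in> S then ennreal (W (retreat xs i) i) * F (retreat xs i) else 0)"
proof -
  have "(\<integral>\<^sup>+ys. ennreal (rate ys xs) * F ys \<partial>count_space (S - {xs})) =
    (\<integral>\<^sup>+ys. (\<Sum>i<N. if ys = retreat xs i then ennreal (W ys i) * F ys else 0) \<partial>count_space (S - {xs}))"
  proof (intro nn_integral_cong)
    fix ys assume "ys \<in> space (count_space (S - {xs}))"
    then have ys: "ys \<in> S" by simp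
    have "ennreal (rate ys xs) = (\<Sum>i<N. ennreal (if xs = advance ys i then W ys i else 0))"
      unfolding tahep_rate_def length_S[OF ys] advance_def
      by (rule sum_ennreal[symmetric]) (auto simp: W_nonneg ys)
    also have "\<dots> = (\<Sum>i<N. if ys = retreat xs i then ennreal (W ys i) else 0)"
      by (intro sum.cong refl) (auto simp: eq_advance_iff length_S[OF ys] length_S[OF xs])
    finally show "ennreal (rate ys xs) * F ys
        = (\<Sum>i<N. if ys = retreat xs i then ennreal (W ys i) * F ys else 0)"
      by (auto simp: sum_distrib_right intro!: sum.cong)
  qed
  also have "\<dots> = (\<Sum>i<N. \<integral>\<^sup>+ys. (if ys = retreat xs i then ennreal (W ys i) * F ys else 0) \<partial>count_space (S - {xs}))"
    by (rule nn_integral_sum) simp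
  also have "\<dots> \<le> (\<Sum>i<N. if retreat xs i \<in> S then ennreal (W (retreat xs i) i) * F (retreat xs i) else 0)"
    by (intro sum_mono) (auto simp: nn_integral_count_space_single)
  finally show ?thesis .
qed

section \<open>Product weights and the candidate law\<close>

definition shape_weight :: "int list \<Rightarrow> real" where
  "shape_weight xs = (\<Prod>i<N - 1. gap_weight (gap xs i)) / Z ^ (N - 1)"

lemma domain_measure_eq: "domain_measure g N y xs = (if xs ! 0 = y then shape_weight xs else 0)"
  by (simp add: domain_measure_def shape_weight_def gap_weight_def gap_def)

lemma shape_weight_nonneg: "0 \<le> shape_weight xs"
  unfolding shape_weight_def using Z_pos gap_weight_pos
  by (intro divide_nonneg_nonneg prod_nonneg zero_le_power) (auto intro: less_imp_le)

text \<open>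
  Both gaps adjacent to the moving particle change by one, and the resulting ratio of weights
  trades the rate of the jump for the rate at which the left neighbour jumps afterwards.
\<close>
lemma W_shape_weight:
  assumes ys: "ys \<in> S" and i: "i < N" and xs: "advance ys i \<in> S"
  shows "W ys i * shape_weight ys =
    (if i = 0 then w else w * g (gap (advance ys i) (i - 1))) * shape_weight (advance ys i)"
proof -
  let ?x = "advance ys i"
  let ?c = "g (gap ys i)" and ?d = "g (gap ?x (i - 1))"
  have nth: "?x ! j = (if j = i then ys ! i + 1 else ys ! j)" if "j < N" for j
    using that length_S[OF ys] by (simp add: advance_def nth_list_update)
  \<comment> \<open>The gap in front of the particle shrinks by one, giving the factor
    \<open>?c\<close>, and the gap behind it grows by one, giving \<open>inverse ?d\<close>. The
    guard \<open>0 < i\<close> is required because \<open>i - 1\<close> is 0 when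
    \<open>i = 0\<close>.\<close>
  have "gap_weight (gap ?x j) = gap_weight (gap ys j) *
      ((if j = i then ?c else 1) * (if j = i - 1 \<and> 0 < i then inverse ?d else 1))" if j: "j < N - 1" for j
  proof -
    have j': "Suc j < N" using j by simp
    note gaps = int_gap[OF ys j'] int_gap[OF xs j']
    consider "j = i" | "Suc j = i" | "j \<noteq> i" "Suc j \<noteq> i" by blast
    then show ?thesis
    proof cases
      case 1
      then have "gap ys j = Suc (gap ?x j)" using gaps j' by (simp add: nth)
      then show ?thesis using 1 g_pos[of "gap ys j"] by (auto simp: gap_weight_Suc)
    next
      case 2
      then have "gap ?x j = Suc (gap ys j)" using gaps j' by (simp add: nth)
      then show ?thesis using 2 by (auto simp: gap_weight_Suc)
    next
      case 3
      then have "gap ?x j = gap ys j" using gaps j' by (simp add: nth)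
      then show ?thesis using 3 by auto
    qed
  qed
  then have "(\<Prod>j<N - 1. gap_weight (gap ?x j)) = (\<Prod>j<N - 1. gap_weight (gap ys j)) *
      ((\<Prod>j<N - 1. if j = i then ?c else 1) *
       (\<Prod>j<N - 1. if j = i - 1 \<and> 0 < i then inverse ?d else 1))"
    by (simp add: prod.distrib)
  also have "(\<Prod>j<N - 1. if j = i then ?c else 1) = (if Suc i < N then ?c else 1)"
    using i by (auto simp: prod.delta)
  also have "(\<Prod>j<N - 1. if j = i - 1 \<and> 0 < i then inverse ?d else 1) = (if 0 < i then inverse ?d else 1)"
  proof (cases "0 < i")
    case True
    then have "i - 1 < N - 1" using i by simp
    with True show ?thesis by (simp add: prod.delta)
  qed simp
  finally have "shape_weight ?x = shape_weight ys * ((if Suc i < N then ?c else 1) * (if 0 < i then inverse ?d else 1))"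
    by (simp add: shape_weight_def)
  \<comment> \<open>The gap behind the particle has just grown, so it is at least one and its
    \<open>g\<close> may be divided by.\<close>
  moreover have "0 < ?d" if "0 < i"
  proof -
    have "Suc (i - 1) = i" "i - 1 \<noteq> i" using that by simp_all
    then have "gap ?x (i - 1) = Suc (gap ys (i - 1))"
      using int_gap[OF ys, of "i - 1"] int_gap[OF xs, of "i - 1"] that i by (simp add: nth)
    then show ?thesis by (simp add: g_pos)
  qed
  ultimately show ?thesis
    using W_eq[OF ys i] by (auto simp: field_simps)
qed

text \<open>The candidate law: of the mixture of domain measures only the one starting at
  \<open>xs ! 0\<close> charges \<open>xs\<close>.\<close>

definition profile :: "int \<Rightarrow> real \<Rightarrow> int list \<Rightarrow> real" where
  "profile a s xs = poisson_weight w s (xs ! 0 - a) * shape_weight xs"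

text \<open>The exit rate without the rate \<open>w\<close> of the rightmost particle.\<close>

definition follower_rates :: "int list \<Rightarrow> real" where
  "follower_rates xs = (\<Sum>i<N - 1. w * g (gap xs i))"

definition profile_inflow :: "int \<Rightarrow> real \<Rightarrow> int list \<Rightarrow> real" where
  "profile_inflow a s xs = shape_weight xs *
    (w * poisson_weight w s (xs ! 0 - a - 1) + poisson_weight w s (xs ! 0 - a) * follower_rates xs)"

lemma follower_rates_nonneg: "0 \<le> follower_rates xs"
  unfolding follower_rates_def using w_pos g_nonneg by (intro sum_nonneg) auto

lemma profile_nonneg: "0 \<le> s \<Longrightarrow> 0 \<le> profile a s xs"
  using w_pos by (simp add: profile_def poisson_weight_nonneg shape_weight_nonneg)

lemma profile_inflow_nonneg: "0 \<le> s \<Longrightarrow> 0 \<le> profile_inflow a s xs"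
  using w_pos
  by (simp add: profile_inflow_def poisson_weight_nonneg shape_weight_nonneg follower_rates_nonneg)

lemma sum_W:
  assumes xs: "xs \<in> S"
  shows "(\<Sum>i<N. W xs i) = w + follower_rates xs"
proof -
  have "(\<Sum>i<N. W xs i) = (\<Sum>i<N. if Suc i < N then w * g (gap xs i) else w)"
    using W_eq[OF xs] by (intro sum.cong) auto
  then show ?thesis using N_pos by (simp add: sum_split_last follower_rates_def less_diff_conv)
qed

text \<open>By \<open>W_shape_weight\<close>, the flow of particle \<open>i + 1\<close> into
  \<open>xs\<close> carries the rate that particle \<open>i\<close> has in \<open>xs\<close>. Summed
  over the particles with a left neighbour this gives \<open>follower_rates xs\<close> after an
  index shift.\<close>

lemma inflow_profile:
  assumes xs: "xs \<in> S" and s: "0 \<le> s"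
  shows "(\<integral>\<^sup>+ys. ennreal (rate ys xs) * ennreal (profile a s ys) \<partial>count_space (S - {xs}))
    \<le> ennreal (profile_inflow a s xs)"
proof -
  \<comment> \<open>\<open>d i\<close> is the flow by a jump of particle \<open>i\<close>. Only the
    leftmost particle alters \<open>xs ! 0\<close>, so only \<open>d 0\<close> has the Poisson
    argument lowered by one.\<close>
  define d where "d i = (if i = 0 then w * poisson_weight w s (xs ! 0 - a - 1)
    else w * g (gap xs (i - 1)) * poisson_weight w s (xs ! 0 - a)) * shape_weight xs" for i
  have d_nonneg: "0 \<le> d i" for i
    using w_pos s g_nonneg by (simp add: d_def poisson_weight_nonneg shape_weight_nonneg)
  have "(\<integral>\<^sup>+ys. ennreal (rate ys xs) * ennreal (profile a s ys) \<partial>count_space (S - {xs}))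
    \<le> (\<Sum>i<N. if retreat xs i \<in> S then ennreal (W (retreat xs i) i) * ennreal (profile a s (retreat xs i)) else 0)"
    by (rule nn_integral_inflow[OF xs])
  also have "\<dots> \<le> (\<Sum>i<N. ennreal (d i))"
  proof (rule sum_mono)
    fix i assume "i \<in> {..<N}"
    then have i: "i < N" by simp
    have "W (retreat xs i) i * profile a s (retreat xs i) = d i" if ys: "retreat xs i \<in> S"
    proof -
      have adv: "advance (retreat xs i) i = xs"
        using eq_advance_iff[of i "retreat xs i" xs] i length_S[OF ys] length_S[OF xs] by simp
      have first: "retreat xs i ! 0 - a = (if i = 0 then xs ! 0 - a - 1 else xs ! 0 - a)"
        using length_S[OF xs] i by (auto simp: retreat_def nth_list_update)
      have "W (retreat xs i) i * profile a s (retreat xs i) =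
          (W (retreat xs i) i * shape_weight (retreat xs i)) * poisson_weight w s (retreat xs i ! 0 - a)"
        by (simp add: profile_def mult_ac)
      also have "\<dots> = d i"
        using W_shape_weight[OF ys i] xs unfolding adv first by (simp add: d_def mult_ac)
      finally show ?thesis .
    qed
    then show "(if retreat xs i \<in> S then ennreal (W (retreat xs i) i) * ennreal (profile a s (retreat xs i)) else 0) \<le> ennreal (d i)"
      using W_nonneg[OF _ i] profile_nonneg[OF s] by (auto simp flip: ennreal_mult)
  qed
  also have "\<dots> = ennreal (\<Sum>i<N. d i)"
    by (rule sum_ennreal) (simp add: d_nonneg)
  also have "(\<Sum>i<N. d i) = profile_inflow a s xs"
    unfolding sum_split_first
    by (simp add: d_def profile_inflow_def follower_rates_def sum_distrib_left sum_distrib_right algebra_simps)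
  finally show ?thesis .
qed

section \<open>A Lyapunov function for non-explosion\<close>

definition spread :: "int list \<Rightarrow> int" where
  "spread xs = (\<Sum>j<N. xs ! (N - 1) - xs ! j)"

lemma spread_nonneg: assumes "xs \<in> S" shows "0 \<le> spread xs"
  unfolding spread_def
proof (rule sum_nonneg)
  fix j assume "j \<in> {..<N}"
  then show "0 \<le> xs ! (N - 1) - xs ! j"
    using assms by (cases "j = N - 1") (auto simp: configurations_iff intro!: less_imp_le)
qed

lemma spread_advance:
  assumes xs: "xs \<in> S" and i: "i < N"
  shows "spread (advance xs i) = (if Suc i < N then spread xs - 1 else spread xs + int N - 1)"
proof -
  have nth: "advance xs i ! j = xs ! j + (if j = i then 1 else 0)" if "j < N" for j
    using that length_S[OF xs] by (simp add: advance_def nth_list_update)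
  \<comment> \<open>A jump of the rightmost particle lengthens all \<open>N\<close> summands by one,
    and the jumping particle's own summand loses one; hence the net change
    \<open>N - 1\<close>.\<close>
  have "spread (advance xs i) =
    (\<Sum>j<N. xs ! (N - 1) - xs ! j + (if i = N - 1 then 1 else 0) - (if j = i then 1 else 0))"
    unfolding spread_def using N_pos by (intro sum.cong) (auto simp: nth)
  also have "\<dots> = spread xs + int N * (if i = N - 1 then 1 else 0) - 1"
    using i by (simp add: spread_def sum.distrib sum_subtractf)
  finally show ?thesis using i by auto
qed

text \<open>A jump of a follower halves \<open>2 powr spread xs\<close>, whatever its rate, and a
  jump of the rightmost particle multiplies it by \<open>2 ^ N / 2\<close>. The unbounded follower
  rates are thus covered by half the exit rate, and the rightmost particle by
  \<open>\<theta> = w * 2 ^ N\<close>.\<close>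

lemma drift_spread:
  assumes xs: "xs \<in> S"
  shows "(\<integral>\<^sup>+ys. ennreal (rate xs ys) * ennreal (2 powr spread ys) \<partial>count_space (S - {xs}))
    \<le> ennreal (1 / 2 * (w * 2 ^ N + (w + follower_rates xs)) * 2 powr spread xs)"
proof -
  have "(\<integral>\<^sup>+ys. ennreal (rate xs ys) * ennreal (2 powr spread ys) \<partial>count_space (S - {xs}))
    = (\<Sum>i<N. ennreal (W xs i * 2 powr spread (advance xs i)))"
    unfolding nn_integral_outflow[OF xs]
    by (intro sum.cong refl) (simp add: W_nonneg[OF xs] flip: ennreal_mult)
  also have "\<dots> = ennreal (\<Sum>i<N. W xs i * 2 powr spread (advance xs i))"
    by (intro sum_ennreal) (simp add: W_nonneg[OF xs])
  also have "(\<Sum>i<N. W xs i * 2 powr spread (advance xs i))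
    = (\<Sum>i<N - 1. w * g (gap xs i) * (2 powr spread xs / 2)) + w * (2 powr spread xs * 2 ^ N / 2)"
    using N_pos unfolding sum_split_last
    by (simp add: spread_advance[OF xs] W_eq[OF xs] less_diff_conv powr_diff powr_add powr_realpow)
  also have "\<dots> = 2 powr spread xs / 2 * follower_rates xs + w * (2 powr spread xs * 2 ^ N / 2)"
    by (simp add: follower_rates_def sum_distrib_left mult_ac)
  also have "\<dots> \<le> 1 / 2 * (w * 2 ^ N + (w + follower_rates xs)) * 2 powr spread xs"
    using w_pos by (simp add: algebra_simps)
  finally show ?thesis by (simp add: ennreal_leI)
qed

section \<open>Law of the exclusion process\<close>

text \<open>The profile is the Poisson mixture of the domain measures, and both the mixing weights
  and each domain measure have mass one.\<close>

lemma nn_integral_profile: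
  assumes s: "0 \<le> s"
  shows "(\<integral>\<^sup>+xs. ennreal (profile a s xs) \<partial>count_space S) = 1"
proof -
  obtain n where N: "N = Suc n" using N_pos by (cases N) auto
  let ?P = "\<lambda>y. ennreal (poisson_weight w s (1 * (y - a)))"
  have "(\<integral>\<^sup>+xs. ennreal (profile a s xs) \<partial>count_space S)
    = (\<integral>\<^sup>+xs. (\<integral>\<^sup>+y. ?P y * ennreal (domain_measure g N y xs) \<partial>count_space UNIV) \<partial>count_space S)"
  proof (intro nn_integral_cong)
    fix xs
    have "(\<integral>\<^sup>+y. ?P y * ennreal (domain_measure g N y xs) \<partial>count_space UNIV) =
      (\<integral>\<^sup>+y. (if y = xs ! 0 then ?P y * ennreal (shape_weight xs) else 0) \<partial>count_space UNIV)"
      by (intro nn_integral_cong) (auto simp: domain_measure_eq)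
    also have "\<dots> = ennreal (profile a s xs)"
      using w_pos s
      by (simp add: nn_integral_count_space_single profile_def poisson_weight_nonneg shape_weight_nonneg ennreal_mult)
    finally show "ennreal (profile a s xs)
      = (\<integral>\<^sup>+y. ?P y * ennreal (domain_measure g N y xs) \<partial>count_space UNIV)" ..
  qed
  also have "\<dots> = (\<integral>\<^sup>+y. (\<integral>\<^sup>+xs. ?P y * ennreal (domain_measure g N y xs) \<partial>count_space S) \<partial>count_space UNIV)"
    by (rule nn_integral_count_space_nn_integral) auto
  also have "\<dots> = (\<integral>\<^sup>+y. ?P y * (\<integral>\<^sup>+xs. ennreal (domain_measure g N y xs) \<partial>count_space S) \<partial>count_space UNIV)"
    by (simp add: nn_integral_cmult)
  also have "\<dots> = 1"
    unfolding N sum_domain_measure using w_pos s by (simp only: mult_1_right) (rule nn_integral_poisson_weight, auto)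
  finally show ?thesis .
qed

lemma tahep_law:
  assumes X: "is_tahep M N (headway_rates w g) (domain_measure g N a) X"
    and t: "0 \<le> t" and xs: "xs \<in> S"
  shows "measure M {\<omega> \<in> space M. X t \<omega> = xs} = profile a t xs"
proof -
  note X = X[unfolded is_tahep_def]
  interpret continuous_time_markov_chain M S rate "domain_measure g N a" X by (rule X)
  have exit: "exit_rate S rate ys = w + follower_rates ys" if ys: "ys \<in> S" for ys
  proof (rule exit_rate_eqI[OF ys])
    show "0 \<le> w + follower_rates ys" using w_pos follower_rates_nonneg[of ys] by simp
    have "(\<Sum>i<N. ennreal (W ys i)) = ennreal (\<Sum>i<N. W ys i)"
      by (rule sum_ennreal) (simp add: W_nonneg ys)
    then show "(\<integral>\<^sup>+zs. ennreal (rate ys zs) \<partial>count_space (S - {ys})) = ennreal (w + follower_rates ys)"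
      using nn_integral_outflow[OF ys, of "\<lambda>_. 1"] sum_W[OF ys] by simp
  qed
  have init: "profile a 0 ys = domain_measure g N a ys" for ys
    by (auto simp: profile_def poisson_weight_0 domain_measure_eq)
  show ?thesis
  proof (rule markov_chain_law[where f="profile a" and D="profile_inflow a"
        and u="\<lambda>xs. 2 powr spread xs" and \<theta>="w * 2 ^ N" and \<beta>="1/2", OF X])
    show "0 < exit_rate S rate ys" if "ys \<in> S" for ys
      using exit[OF that] w_pos follower_rates_nonneg[of ys] by simp
    show "(\<integral>\<^sup>+ys. ennreal (domain_measure g N a ys) \<partial>count_space S) = 1"
      using nn_integral_profile[of 0 a] by (simp add: init)
    show "((\<lambda>s. profile a s ys) has_real_derivative
        profile_inflow a s ys - exit_rate S rate ys * profile a s ys) (at s)" if "ys \<in> S" for s ys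
      unfolding profile_def profile_inflow_def exit[OF that]
      by (rule DERIV_cong[OF DERIV_cmult_right[OF has_derivative_poisson_weight]])
        (simp add: algebra_simps)
    show "continuous_on UNIV (\<lambda>s. profile_inflow a s ys)" for ys
      unfolding profile_inflow_def by (intro continuous_intros)
    show "(\<integral>\<^sup>+ys. ennreal (rate xs ys) * ennreal (2 powr real_of_int (spread ys)) \<partial>count_space (S - {xs}))
      \<le> ennreal (1 / 2 * (w * 2 ^ N + exit_rate S rate xs) * 2 powr real_of_int (spread xs))" if "xs \<in> S" for xs
      unfolding exit[OF that] by (rule drift_spread[OF that])
    show "1 \<le> 2 powr real_of_int (spread ys)" if "ys \<in> S" for ys
      using spread_nonneg[OF that] by (intro ge_one_powr_ge_zero) auto
    show "(\<integral>\<^sup>+ys. ennreal (rate ys zs) * ennreal (profile a s ys) \<partial>count_space (S - {zs}))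
      \<le> ennreal (profile_inflow a s zs)" if "0 \<le> s" "zs \<in> S" for s zs
      using inflow_profile that by simp
  qed (use w_pos t xs in \<open>auto simp: init profile_nonneg profile_inflow_nonneg nn_integral_profile\<close>)
qed

end

theorem theorem4p7:
  fixes w :: real and g :: "nat \<Rightarrow> real" and N :: nat and xstar :: int
    and M :: "'m measure" and X :: "real \<Rightarrow> 'm \<Rightarrow> int list" and t :: real
  assumes "0 < w" and "g 0 = 0" and "\<And>k. 1 \<le> k \<Longrightarrow> 0 < g k"
    and "summable (\<lambda>n. \<Prod>k=1..n. inverse (g k))"
    and "1 \<le> N"
    and "is_tahep M N (headway_rates w g) (domain_measure g N xstar) X"
    and "0 < t"
  shows "(\<forall>xs \<in> configurations N.
      ((\<lambda>y. walk_weight w t y xstar * domain_measure g N y xs)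
         has_sum measure M {\<omega> \<in> space M. X t \<omega> = xs}) {xstar..})
    \<and> (\<forall>y \<ge> xstar. 0 \<le> walk_weight w t y xstar)
    \<and> ((\<lambda>y. walk_weight w t y xstar) has_sum 1) {xstar..}
    \<and> (\<forall>y \<ge> xstar. \<forall>(ML :: 'l measure) L. is_left_walk ML w y L \<longrightarrow>
         measure ML {\<omega> \<in> space ML. L t \<omega> = xstar} = walk_weight w t y xstar)
    \<and> (\<forall>y \<ge> xstar. \<forall>(MR :: 'r measure) R. is_right_walk MR w xstar R \<longrightarrow>
         measure MR {\<omega> \<in> space MR. R t \<omega> = y} = walk_weight w t y xstar)"
proof (intro conjI ballI allI impI)
  interpret tahep_parameters g w N
    by unfold_locales (use assms in auto)
  have t: "0 \<le> t" using \<open>0 < t\<close> by simp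
  show "((\<lambda>y. walk_weight w t y xstar * domain_measure g N y xs)
         has_sum measure M {\<omega> \<in> space M. X t \<omega> = xs}) {xstar..}" if "xs \<in> configurations N" for xs
    unfolding tahep_law[OF assms(6) t that]
  \<comment> \<open>At most the term \<open>y = xs ! 0\<close> of the sum is nonzero. If it lies to
    the left of \<open>xstar\<close>, the sum is 0, and so is the Poisson weight of the negative
    displacement in \<open>profile\<close>.\<close>
  proof (cases "xstar \<le> xs ! 0")
    case True
    then have "((\<lambda>y. walk_weight w t y xstar * domain_measure g N y xs) has_sum
        walk_weight w t (xs ! 0) xstar * domain_measure g N (xs ! 0) xs) {xs ! 0}"
      using has_sum_finite[of "{xs ! 0}" "\<lambda>y. walk_weight w t y xstar * domain_measure g N y xs"] by simp
    also have "?this \<longleftrightarrow> ((\<lambda>y. walk_weight w t y xstar * domain_measure g N y xs) has_sum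
        walk_weight w t (xs ! 0) xstar * domain_measure g N (xs ! 0) xs) {xstar..}"
      using True by (intro has_sum_cong_neutral) (auto simp: domain_measure_eq)
    finally show "((\<lambda>y. walk_weight w t y xstar * domain_measure g N y xs)
         has_sum profile xstar t xs) {xstar..}"
      using True by (simp add: profile_def walk_weight_eq_poisson_weight domain_measure_eq)
  next
    case False
    then have "((\<lambda>y. walk_weight w t y xstar * domain_measure g N y xs) has_sum 0) {xstar..}"
      by (intro has_sum_0) (auto simp: domain_measure_eq)
    then show "((\<lambda>y. walk_weight w t y xstar * domain_measure g N y xs)
         has_sum profile xstar t xs) {xstar..}"
      using False by (simp add: profile_def poisson_weight_def)
  qed
  show "0 \<le> walk_weight w t y xstar" if "xstar \<le> y" for y
    using that w_pos t by (simp add: walk_weight_eq_poisson_weight poisson_weight_nonneg)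
  have "((\<lambda>y. walk_weight w t y xstar) has_sum 1) {xstar..} \<longleftrightarrow>
      ((\<lambda>y. poisson_weight w t (y - xstar)) has_sum 1) {xstar..}"
    by (intro has_sum_cong) (simp add: walk_weight_eq_poisson_weight)
  then show "((\<lambda>y. walk_weight w t y xstar) has_sum 1) {xstar..}"
    using has_sum_poisson_weight[of w t xstar] w_pos t by simp
  \<comment> \<open>The left walk from \<open>y\<close> to \<open>xstar\<close> makes
    \<open>y - xstar\<close> steps, just as the right walk from \<open>xstar\<close> to
    \<open>y\<close>; the sign -1 turns the negative displacement into this number.\<close>
  show "measure M' {\<omega> \<in> space M'. L t \<omega> = xstar} = walk_weight w t y xstar"
    if "xstar \<le> y" "is_left_walk M' w y L" for y and M' :: "'l measure" and L
    using asymmetric_walk_law[of w t "- 1" M' y L xstar] that w_pos t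
    by (simp add: is_left_walk_def walk_weight_eq_poisson_weight)
  show "measure M' {\<omega> \<in> space M'. R t \<omega> = y} = walk_weight w t y xstar"
    if "xstar \<le> y" "is_right_walk M' w xstar R" for y and M' :: "'r measure" and R
    using asymmetric_walk_law[of w t 1 M' xstar R y] that w_pos t
    by (simp add: is_right_walk_def walk_weight_eq_poisson_weight)
qed

end
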